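(* For all positive integers $i,j,k$ with $i+1<j<k$, the relation $(t_i\,q_{[j,k]})^2=I$ holds in the Berenstein-Kirillov group $\mathcal{BK}$, where $q_{[j,k]}=q_{k-1}\,q_{k-j}\,q_{k-1}$ and $q_m=t_1(t_2t_1)(t_3t_2t_1)\cdots(t_mt_{m-1}\cdots t_1)$.
   Context: Semistandard Young tableaux (SSYT) are fillings of Young diagrams of partitions (straight shapes) by positive integers, weakly increasing along rows and strictly increasing down columns. Bender-Knuth moves: for $i\ge1$, $t_i$ acts on an SSYT $T$ as follows. Consider only the boxes with entry $i$ or $i+1$. Each row of this skew tableau consists, from left to right, of $a$ entries $i$ lying directly above an $i+1$, then $b$ entries $i$ alone in their columns (among boxes with entry $i$ or $i+1$), then $c$ entries $i+1$ alone in their columns, then $d$ entries $i+1$ lying directly below an $i$. In every row, replace the $b$ free $i$'s followed by $c$ free $(i+1)$'s by $c$ $i$'s followed by $b$ $(i+1)$'s. All other entries are unchanged. The Berenstein-Kirillov group $\mathcal{BK}$ is the free group on $t_i$, $i\in\mathbb Z_{>0}$, modulo all relations satisfied by the $t_i$ acting on all SSYT of all partition shapes (equivalently, the group of permutations of the set of all SSYT generated by the Bender-Knuth moves). *)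

theory Defs
  imports "HOL-Algebra.Bij" "HOL-Algebra.Generated_Groups"
begin

definition is_partition :: "nat list \<Rightarrow> bool" where
  "is_partition p \<longleftrightarrow> sorted_wrt (\<ge>) p \<and> (\<forall>x \<in> set p. 0 < x)"

definition diagram :: "nat list \<Rightarrow> (nat \<times> nat) set" where
  "diagram p = {(r, c). r < length p \<and> c < p ! r}"

text \<open>
  Rows and columns are numbered from 0, row 0 being the top row. A tableau is the function
  sending a box (row, column) to its entry and everything outside the diagram to 0. As entries
  are positive, the function determines the shape, so the tableaux of all shapes form one set
  of functions.
\<close>

type_synonym tableau = "nat \<Rightarrow> nat \<Rightarrow> nat"

definition ssyt_of_shape :: "nat list \<Rightarrow> tableau set" where
  "ssyt_of_shape p = {T.
     (\<forall>r c. (r, c) \<in> diagram p \<longrightarrow> 0 < T r c) \<and>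
     (\<forall>r c. (r, c) \<notin> diagram p \<longrightarrow> T r c = 0) \<and>
     (\<forall>r c c'. c < c' \<and> (r, c') \<in> diagram p \<longrightarrow> T r c \<le> T r c') \<and>
     (\<forall>r r' c. r < r' \<and> (r', c) \<in> diagram p \<longrightarrow> T r c < T r' c)}"

definition SSYT :: "tableau set" where
  "SSYT = (\<Union>p \<in> {p. is_partition p}. ssyt_of_shape p)"

text \<open>
  The columns of the boxes of row \<open>r\<close> that have entry \<open>i\<close> or \<open>i + 1\<close> and are
  alone in their column among the boxes with entry \<open>i\<close> or \<open>i + 1\<close>.
\<close>

definition free_cols :: "nat \<Rightarrow> tableau \<Rightarrow> nat \<Rightarrow> nat set" where
  "free_cols i T r =
     {c. T r c \<in> {i, Suc i} \<and> (\<forall>r'. T r' c \<in> {i, Suc i} \<longrightarrow> r' = r)}"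

text \<open>
  With \<open>k\<close> the number of free entries \<open>i + 1\<close> of a row, its leftmost \<open>k\<close> free boxes
  receive \<open>i\<close> and its other free boxes receive \<open>i + 1\<close>. Only \<open>i \<ge> 1\<close> is meaningful,
  since 0 marks the positions outside the shape.
\<close>

definition bender_knuth :: "nat \<Rightarrow> tableau \<Rightarrow> tableau" where
  "bender_knuth i T = (\<lambda>r c.
     let F = free_cols i T r; k = card {c' \<in> F. T r c' = Suc i} in
     if c \<in> F then (if card {c' \<in> F. c' < c} < k then i else Suc i) else T r c)"

definition bk_move :: "nat \<Rightarrow> (tableau \<Rightarrow> tableau)" where
  "bk_move i = restrict (bender_knuth i) SSYT"

definition BK :: "(tableau \<Rightarrow> tableau) monoid" where
  "BK = subgroup_generated (BijGroup SSYT) (bk_move ` {1..})"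

text \<open>\<open>bk_desc m\<close> is the product \<open>t\<^sub>m \<dots> t\<^sub>2 t\<^sub>1\<close>.\<close>

primrec bk_desc :: "nat \<Rightarrow> (tableau \<Rightarrow> tableau)" where
  "bk_desc 0 = \<one>\<^bsub>BK\<^esub>"
| "bk_desc (Suc m) = bk_move (Suc m) \<otimes>\<^bsub>BK\<^esub> bk_desc m"

primrec bk_q :: "nat \<Rightarrow> (tableau \<Rightarrow> tableau)" where
  "bk_q 0 = \<one>\<^bsub>BK\<^esub>"
| "bk_q (Suc m) = bk_q m \<otimes>\<^bsub>BK\<^esub> bk_desc (Suc m)"

definition bk_q_interval :: "nat \<Rightarrow> nat \<Rightarrow> (tableau \<Rightarrow> tableau)" where
  "bk_q_interval j k = bk_q (k - 1) \<otimes>\<^bsub>BK\<^esub> bk_q (k - j) \<otimes>\<^bsub>BK\<^esub> bk_q (k - 1)"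

text \<open>
  The product of \<open>BijGroup\<close> is composition only on its carrier, so the definitions above
  are meaningful because of the following: every \<open>bender_knuth i\<close> with \<open>i \<ge> 1\<close> is an
  involution of \<open>SSYT\<close>.
\<close>

lemma diagram_left: "(r, c') \<in> diagram p \<Longrightarrow> c \<le> c' \<Longrightarrow> (r, c) \<in> diagram p"
  by (auto simp: diagram_def)

lemma diagram_up:
  assumes "is_partition p" "(r', c) \<in> diagram p" "r \<le> r'"
  shows "(r, c) \<in> diagram p"
proof (cases "r = r'")
  case False
  then have "r < r'" "r' < length p" using assms by (auto simp: diagram_def)
  then have "p ! r' \<le> p ! r"
    using assms(1) by (auto simp: is_partition_def sorted_wrt_iff_nth_less)
  then show ?thesis using assms(2) \<open>r < r'\<close> by (auto simp: diagram_def)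
qed (use assms in simp)

lemma finite_diagram_row: "finite {c. (r, c) \<in> diagram p}"
  by (rule finite_subset[of _ "{..<p ! r}"]) (auto simp: diagram_def)

lemma free_cols_entry: "c \<in> free_cols i T r \<Longrightarrow> T r c = i \<or> T r c = Suc i"
  by (simp add: free_cols_def)

lemma free_cols_unique:
  "c \<in> free_cols i T r \<Longrightarrow> T r' c = i \<or> T r' c = Suc i \<Longrightarrow> r' = r"
  unfolding free_cols_def by blast

lemma bender_knuth_free:
  "c \<in> free_cols i T r \<Longrightarrow> bender_knuth i T r c = i \<or> bender_knuth i T r c = Suc i"
  by (simp add: bender_knuth_def Let_def)

lemma bender_knuth_mem_iff: "bender_knuth i T r c \<in> {i, Suc i} \<longleftrightarrow> T r c \<in> {i, Suc i}"
  by (auto simp: bender_knuth_def free_cols_def Let_def)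

lemma bender_knuth_other: "T r c \<notin> {i, Suc i} \<Longrightarrow> bender_knuth i T r c = T r c"
  by (auto simp: bender_knuth_def free_cols_def Let_def)

lemma free_cols_bender_knuth: "free_cols i (bender_knuth i T) r = free_cols i T r"
  by (simp only: free_cols_def bender_knuth_mem_iff)

lemma finite_free_cols:
  assumes "T \<in> ssyt_of_shape p" and "1 \<le> i"
  shows "finite (free_cols i T r)"
proof (rule finite_subset[OF _ finite_diagram_row[of r p]])
  show "free_cols i T r \<subseteq> {c. (r, c) \<in> diagram p}"
  proof
    fix c assume "c \<in> free_cols i T r"
    then have "T r c \<noteq> 0" using assms(2) free_cols_entry by fastforce
    then show "c \<in> {c. (r, c) \<in> diagram p}"
      using assms(1) unfolding ssyt_of_shape_def mem_Collect_eq by metis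
  qed
qed

lemma bender_knuth_row:
  assumes p: "is_partition p" and T: "T \<in> ssyt_of_shape p" and i: "1 \<le> i"
    and cc: "c < c'" and d: "(r, c') \<in> diagram p"
  shows "bender_knuth i T r c \<le> bender_knuth i T r c'"
proof -
  let ?F = "free_cols i T r"
  have pos: "\<And>r c. (r, c) \<in> diagram p \<Longrightarrow> 0 < T r c"
    and zero: "\<And>r c. (r, c) \<notin> diagram p \<Longrightarrow> T r c = 0"
    and row: "\<And>r c c'. c < c' \<Longrightarrow> (r, c') \<in> diagram p \<Longrightarrow> T r c \<le> T r c'"
    and col: "\<And>r r' c. r < r' \<Longrightarrow> (r', c) \<in> diagram p \<Longrightarrow> T r c < T r' c"
    using T by (auto simp: ssyt_of_shape_def)
  have le: "T r c \<le> T r c'" using row cc d by blast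
  consider "c \<in> ?F" "c' \<in> ?F" | "c \<in> ?F" "c' \<notin> ?F" | "c \<notin> ?F" "c' \<in> ?F" | "c \<notin> ?F" "c' \<notin> ?F"
    by blast
  then show ?thesis
  proof cases
    case 1
    have "card {x \<in> ?F. x < c} \<le> card {x \<in> ?F. x < c'}"
      using finite_free_cols[OF T i] cc by (intro card_mono) auto
    then show ?thesis using 1 by (auto simp: bender_knuth_def Let_def)
  next
    case 2
    have v: "bender_knuth i T r c' = T r c'" using 2 by (simp add: bender_knuth_def Let_def)
    have "T r c' \<noteq> i"
    proof
      assume e: "T r c' = i"
      then have "T r c = i" using free_cols_entry[OF 2(1)] le by auto
      obtain s where s: "T s c' \<in> {i, Suc i}" "s \<noteq> r"
        using 2(2) e unfolding free_cols_def by blast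
      have ds: "(s, c') \<in> diagram p"
        by (rule ccontr) (use zero[of s c'] s(1) i in simp)
      have rs: "r < s" using col[of s r c'] d e s by (cases s r rule: linorder_cases) auto
      have "(s, c) \<in> diagram p" using diagram_left ds cc by (meson less_imp_le)
      then have "T r c < T s c" using col rs by blast
      moreover have "T s c \<le> T s c'" using row cc ds by blast
      ultimately have "T s c \<in> {i, Suc i}" using s \<open>T r c = i\<close> by auto
      then show False using free_cols_unique[OF 2(1), of s] s(2) by auto
    qed
    moreover have "T r c \<ge> i" "bender_knuth i T r c \<le> Suc i"
      using free_cols_entry[OF 2(1)] bender_knuth_free[OF 2(1)] by auto
    ultimately show ?thesis using le v by simp
  next
    case 3
    have v: "bender_knuth i T r c = T r c" using 3 by (simp add: bender_knuth_def Let_def)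
    have "T r c \<noteq> Suc i"
    proof
      assume e: "T r c = Suc i"
      then have e': "T r c' = Suc i" using free_cols_entry[OF 3(2)] le by auto
      have dc: "(r, c) \<in> diagram p" using diagram_left d cc by (meson less_imp_le)
      obtain s where s: "T s c \<in> {i, Suc i}" "s \<noteq> r"
        using 3(1) e unfolding free_cols_def by blast
      have ds: "(s, c) \<in> diagram p"
        by (rule ccontr) (use zero[of s c] s(1) i in simp)
      have rs: "s < r" using col[of r s c] ds e s by (cases s r rule: linorder_cases) auto
      have ds': "(s, c') \<in> diagram p" using diagram_up[OF p d] rs by simp
      have "T s c = i" using col[OF rs dc] e s by auto
      moreover have "T s c \<le> T s c'" using row[OF cc ds'] .
      moreover have "T s c' < T r c'" using col[OF rs d] .
      ultimately have "T s c' = i" using e' by simp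
      then show False using free_cols_unique[OF 3(2), of s] s(2) by auto
    qed
    moreover have "T r c' \<le> Suc i" "bender_knuth i T r c' \<ge> i"
      using free_cols_entry[OF 3(2)] bender_knuth_free[OF 3(2)] by auto
    ultimately show ?thesis using le v by simp
  next
    case 4
    then show ?thesis using le by (simp add: bender_knuth_def Let_def)
  qed
qed

lemma bender_knuth_SSYT:
  assumes T: "T \<in> SSYT" and i: "1 \<le> i"
  shows "bender_knuth i T \<in> SSYT"
proof -
  obtain p where p: "is_partition p" and Tp: "T \<in> ssyt_of_shape p"
    using T by (auto simp: SSYT_def)
  have pos: "\<And>r c. (r, c) \<in> diagram p \<Longrightarrow> 0 < T r c"
    and zero: "\<And>r c. (r, c) \<notin> diagram p \<Longrightarrow> T r c = 0"
    and col: "\<And>r r' c. r < r' \<Longrightarrow> (r', c) \<in> diagram p \<Longrightarrow> T r c < T r' c"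
    using Tp by (auto simp: ssyt_of_shape_def)
  have "0 < bender_knuth i T r c" if "(r, c) \<in> diagram p" for r c
    using pos[OF that] i by (auto simp: bender_knuth_def Let_def)
  moreover have "bender_knuth i T r c = 0" if "(r, c) \<notin> diagram p" for r c
    using zero[OF that] i by (subst bender_knuth_other) auto
  moreover have "bender_knuth i T r c < bender_knuth i T r' c"
    if "r < r'" "(r', c) \<in> diagram p" for r r' c
  proof -
    have lt: "T r c < T r' c" using col that .
    consider "c \<in> free_cols i T r" | "c \<in> free_cols i T r'"
      | "c \<notin> free_cols i T r" "c \<notin> free_cols i T r'" by blast
    then show ?thesis
    proof cases
      case 1
      have o: "T r' c \<notin> {i, Suc i}" and "T r c \<in> {i, Suc i}"
        using that(1) free_cols_unique[OF 1, of r'] free_cols_entry[OF 1] by auto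
      then have "Suc i < T r' c" using lt by auto
      moreover have "bender_knuth i T r c \<le> Suc i"
        using bender_knuth_free[OF 1] by auto
      ultimately show ?thesis using bender_knuth_other[of T, OF o] by simp
    next
      case 2
      have o: "T r c \<notin> {i, Suc i}" and "T r' c \<in> {i, Suc i}"
        using that(1) free_cols_unique[OF 2, of r] free_cols_entry[OF 2] by auto
      then have "T r c < i" using lt by auto
      moreover have "i \<le> bender_knuth i T r' c"
        using bender_knuth_free[OF 2] by auto
      ultimately show ?thesis using bender_knuth_other[of T, OF o] by simp
    next
      case 3
      then show ?thesis using lt by (simp add: bender_knuth_def Let_def)
    qed
  qed
  ultimately have "bender_knuth i T \<in> ssyt_of_shape p"
    using bender_knuth_row[OF p Tp i] by (simp add: ssyt_of_shape_def)
  then show ?thesis using p by (auto simp: SSYT_def)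
qed

lemma card_rank_less:
  fixes F :: "nat set"
  assumes "finite F"
  shows "card {c \<in> F. card {c' \<in> F. c' < c} < m} = min m (card F)"
  using assms
proof (induction rule: finite_linorder_max_induct)
  case empty
  then show ?case by simp
next
  case (insert b A)
  have eq: "{c' \<in> insert b A. c' < c} = {c' \<in> A. c' < c}" if "c \<in> A" for c
    using insert.hyps(2) that by auto
  have eqb: "{c' \<in> insert b A. c' < b} = A"
    using insert.hyps(2) by auto
  have b: "b \<notin> A" using insert.hyps(2) by blast
  have "{c \<in> insert b A. card {c' \<in> insert b A. c' < c} < m} =
      {c \<in> A. card {c' \<in> A. c' < c} < m} \<union> (if card A < m then {b} else {})"
  proof (rule Set.set_eqI)
    fix c
    show "c \<in> {c \<in> insert b A. card {c' \<in> insert b A. c' < c} < m} \<longleftrightarrow>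
        c \<in> {c \<in> A. card {c' \<in> A. c' < c} < m} \<union> (if card A < m then {b} else {})"
      by (cases "c = b"; cases "c \<in> A") (simp_all add: eq eqb b del: insert_iff,
        simp_all add: eq)
  qed
  then show ?case
    using insert b by (auto simp: card_insert_if)
qed

lemma free_row_sorted:
  assumes T: "T \<in> ssyt_of_shape p" and i: "1 \<le> i" and c: "c \<in> free_cols i T r"
  shows "T r c = i \<longleftrightarrow>
    card {c' \<in> free_cols i T r. c' < c} < card {c' \<in> free_cols i T r. T r c' = i}"
proof -
  let ?F = "free_cols i T r"
  have fin: "finite ?F" using finite_free_cols[OF T i] .
  have row: "T r x \<le> T r y" if "x < y" "y \<in> ?F" for x y
  proof -
    have "T r y \<noteq> 0" using free_cols_entry[OF that(2)] i by auto
    moreover have "(r, y) \<notin> diagram p \<longrightarrow> T r y = 0"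
      using T unfolding ssyt_of_shape_def by blast
    ultimately have "(r, y) \<in> diagram p" by metis
    moreover have "\<forall>r c c'. c < c' \<and> (r, c') \<in> diagram p \<longrightarrow> T r c \<le> T r c'"
      using T unfolding ssyt_of_shape_def by blast
    ultimately show ?thesis using that(1) by blast
  qed
  show ?thesis
  proof
    assume e: "T r c = i"
    have "T r x = i" if "x \<in> ?F" "x < c" for x
    proof -
      have "T r x \<in> {i, Suc i}" using that(1) unfolding free_cols_def by blast
      then show ?thesis using row[OF that(2) c] e by auto
    qed
    then have "{c' \<in> ?F. c' < c} \<subset> {c' \<in> ?F. T r c' = i}"
      using c e by blast
    then show "card {c' \<in> ?F. c' < c} < card {c' \<in> ?F. T r c' = i}"
      using fin by (intro psubset_card_mono) auto
  next
    assume l: "card {c' \<in> ?F. c' < c} < card {c' \<in> ?F. T r c' = i}"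
    show "T r c = i"
    proof (rule ccontr)
      assume "T r c \<noteq> i"
      then have e: "T r c = Suc i" using c unfolding free_cols_def by blast
      have "x < c" if "x \<in> ?F" "T r x = i" for x
      proof (rule ccontr)
        assume "\<not> x < c"
        then have "c < x" using that e by (metis n_not_Suc_n linorder_neqE_nat)
        then show False using row[of c x] that e by simp
      qed
      then have "{c' \<in> ?F. T r c' = i} \<subseteq> {c' \<in> ?F. c' < c}" by auto
      then have "card {c' \<in> ?F. T r c' = i} \<le> card {c' \<in> ?F. c' < c}"
        using fin by (intro card_mono) auto
      then show False using l by simp
    qed
  qed
qed

lemma bender_knuth_involution:
  assumes T: "T \<in> SSYT" and i: "1 \<le> i"
  shows "bender_knuth i (bender_knuth i T) = T"
proof (intro ext)
  fix r c
  obtain p where Tp: "T \<in> ssyt_of_shape p"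
    using T by (auto simp: SSYT_def)
  let ?F = "free_cols i T r" and ?S = "bender_knuth i T"
  have fin: "finite ?F" using finite_free_cols[OF Tp i] .
  let ?k = "card {c' \<in> ?F. T r c' = Suc i}"
  have split: "card {c' \<in> ?F. f c' = i} + card {c' \<in> ?F. f c' = Suc i} = card ?F"
    if "\<And>x. x \<in> ?F \<Longrightarrow> f x \<in> {i, Suc i}" for f :: "nat \<Rightarrow> nat"
  proof -
    have "?F = {c' \<in> ?F. f c' = i} \<union> {c' \<in> ?F. f c' = Suc i}" using that by auto
    moreover have "card ({c' \<in> ?F. f c' = i} \<union> {c' \<in> ?F. f c' = Suc i}) =
        card {c' \<in> ?F. f c' = i} + card {c' \<in> ?F. f c' = Suc i}"
      using fin by (intro card_Un_disjoint) auto
    ultimately show ?thesis by simp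
  qed
  have sT: "card {c' \<in> ?F. T r c' = i} + ?k = card ?F"
    by (rule split) (use free_cols_entry in blast)
  have sS: "card {c' \<in> ?F. ?S r c' = i} + card {c' \<in> ?F. ?S r c' = Suc i} = card ?F"
    by (rule split) (use bender_knuth_free in blast)
  have "{c' \<in> ?F. ?S r c' = i} = {c' \<in> ?F. card {x \<in> ?F. x < c'} < ?k}"
    by (auto simp: bender_knuth_def Let_def)
  then have "card {c' \<in> ?F. ?S r c' = i} = min ?k (card ?F)"
    using card_rank_less[OF fin] by simp
  then have k: "card {c' \<in> ?F. ?S r c' = Suc i} = card {c' \<in> ?F. T r c' = i}"
    using sT sS by simp
  show "bender_knuth i ?S r c = T r c"
  proof (cases "c \<in> ?F")
    case True
    then have "bender_knuth i ?S r c =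
        (if card {c' \<in> ?F. c' < c} < card {c' \<in> ?F. T r c' = i} then i else Suc i)"
      unfolding bender_knuth_def[of i ?S] Let_def free_cols_bender_knuth k by simp
    moreover have "T r c \<in> {i, Suc i}" using True by (simp add: free_cols_def)
    ultimately show ?thesis using free_row_sorted[OF Tp i True] by auto
  next
    case False
    then show ?thesis
      unfolding bender_knuth_def[of i ?S] Let_def free_cols_bender_knuth
      by (simp add: bender_knuth_def Let_def)
  qed
qed

lemma bk_move_Bij:
  assumes "1 \<le> i"
  shows "bk_move i \<in> carrier (BijGroup SSYT)"
proof -
  have "bij_betw (bender_knuth i) SSYT SSYT"
    by (rule bij_betw_byWitness[where f' = "bender_knuth i"])
      (use assms bender_knuth_SSYT bender_knuth_involution in auto)
  then have "bij_betw (bk_move i) SSYT SSYT"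
    unfolding bk_move_def by (simp add: bij_betw_def inj_on_def)
  then show ?thesis
    by (simp add: BijGroup_def Bij_def bk_move_def)
qed

lemma group_BK: "group BK"
  unfolding BK_def by (intro group.group_subgroup_generated group_BijGroup)

lemma bk_move_in_BK: "1 \<le> i \<Longrightarrow> bk_move i \<in> carrier BK"
  unfolding BK_def using bk_move_Bij
  by (auto simp: carrier_subgroup_generated intro!: generate.incl)

end

theory Submission
  imports Defs
begin

text \<open>
  A tableau is encoded by its Gelfand-Tsetlin pattern, on which \<open>t\<^sub>i\<close> is a toggle of level \<open>i\<close> that
  sees only the levels \<open>i - 1\<close> and \<open>i + 1\<close>. Let \<open>p\<^sub>m = t\<^sub>m \<dots> t\<^sub>1\<close>, \<open>n = k - j\<close>, \<open>s = j - 1\<close> and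
  \<open>P = p\<^sub>n\<^sub>+\<^sub>1 \<dots> p\<^sub>n\<^sub>+\<^sub>s\<close>. As the \<open>q\<^sub>m\<close> are involutions, \<open>q\<^sub>[\<^sub>j\<^sub>,\<^sub>k\<^sub>] = P\<inverse> q\<^sub>n P\<close>, and it suffices that
  \<open>t\<^sub>i\<close> commutes with it. The crystal raising operators \<open>e\<^sub>l\<close> satisfy \<open>t\<^sub>l\<^sub>+\<^sub>1 t\<^sub>l e\<^sub>l\<^sub>+\<^sub>1 = e\<^sub>l t\<^sub>l\<^sub>+\<^sub>1 t\<^sub>l\<close>
  (they commute with jeu de taquin), hence \<open>P e\<^sub>l\<^sub>+\<^sub>s = e\<^sub>l P\<close> for \<open>1 \<le> l \<le> n\<close>, and \<open>e\<^sub>l\<^sub>+\<^sub>s\<close> commutes with \<open>t\<^sub>i\<close>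
  by locality; so \<open>\<theta> = P t\<^sub>i P\<inverse>\<close> commutes with \<open>e\<^sub>1, \<dots>, e\<^sub>n\<close>. Now \<open>X = P T\<close> and \<open>q\<^sub>n X\<close> differ only below
  level \<open>n + 1\<close>, so both are raised to the same highest weight pattern \<open>H\<close>. Since \<open>\<theta> H\<close> is again
  of highest weight and of the same content, it agrees with \<open>H\<close> up to level \<open>n + 1\<close>, and by injectivity of
  the \<open>e\<^sub>l\<close> so do \<open>\<theta> X\<close> with \<open>X\<close> and \<open>\<theta> q\<^sub>n X\<close> with \<open>q\<^sub>n X\<close>. This gives \<open>q\<^sub>n \<theta> X = \<theta> q\<^sub>n X\<close>.
\<close>

section \<open>Three consecutive levels\<close>

text \<open>Reflects \<open>b r\<close> in the interval of values that interlacing with the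
  neighbouring rows \<open>a\<close> and \<open>c\<close> allows; in row 0 the upper end is
  \<open>c 0\<close> alone.\<close>

definition flip :: "(nat \<Rightarrow> int) \<Rightarrow> (nat \<Rightarrow> int) \<Rightarrow> (nat \<Rightarrow> int) \<Rightarrow> nat \<Rightarrow> int" where
  "flip a c b r =
     (if r = 0 then c 0 else min (a (r - 1)) (c r)) + max (a r) (c (Suc r)) - b r"

definition excess :: "(nat \<Rightarrow> int) \<Rightarrow> (nat \<Rightarrow> int) \<Rightarrow> (nat \<Rightarrow> int) \<Rightarrow> nat \<Rightarrow> int" where
  "excess a b c r = (\<Sum>s\<le>r. c s - b s) - (\<Sum>s<r. b s - a s)"

text \<open>
  Rows \<open>a\<close>, \<open>b\<close>, \<open>c\<close> are consecutive levels \<open>i - 1\<close>, \<open>i\<close>, \<open>i + 1\<close>. In the reading word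
  from the top right, \<open>excess a b c r\<close> counts the letters \<open>i + 1\<close> minus the letters \<open>i\<close> up to the
  last \<open>i + 1\<close> of row \<open>r\<close>. The crystal raising operator turns an \<open>i + 1\<close> into an \<open>i\<close> in the first row
  where the excess is maximal, provided the maximum is positive.
\<close>

definition raise_row ::
    "(nat \<Rightarrow> int) \<Rightarrow> (nat \<Rightarrow> int) \<Rightarrow> (nat \<Rightarrow> int) \<Rightarrow> nat \<Rightarrow> bool" where
  "raise_row a b c p \<longleftrightarrow> 0 < excess a b c p
     \<and> (\<forall>s<p. excess a b c s < excess a b c p) \<and> (\<forall>s. excess a b c s \<le> excess a b c p)"

lemma flip_flip: "flip a c (flip a c b) = b"
  by (auto simp: flip_def fun_eq_iff)

text \<open>Telescoping: the maximum in entry \<open>s\<close> and the minimum in entry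
  \<open>Suc s\<close> add up to \<open>a s + c (Suc s)\<close>, so only the last maximum
  survives.\<close>

lemma sum_flip:
  "(\<Sum>s\<le>r. flip a c b s) = (\<Sum>s\<le>r. c s) - (\<Sum>s\<le>r. b s) + (\<Sum>s<r. a s) + max (a r) (c (Suc r))"
proof (induction r)
  case (Suc r)
  have "(\<Sum>s<Suc r. a s) = (\<Sum>s<r. a s) + a r" by simp
  with Suc show ?case by (auto simp: flip_def)
qed (simp add: flip_def)

lemma sum_atMost_eq: "(\<Sum>s\<le>r. f s) = (\<Sum>s<r. f s) + f r" for f :: "nat \<Rightarrow> int"
  by (metis lessThan_Suc_atMost sum.lessThan_Suc)

text \<open>
  Sliding a letter past a two-letter skew tableau: each value of the old excess reappears in
  the same row or in the row above, and with no loss in at least one of the two.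
\<close>

lemma excess_slide:
  fixes a0 a1 a2 b0 :: "nat \<Rightarrow> int"
  defines "b1 \<equiv> flip b0 a1 a0"
  defines "b2 \<equiv> flip b1 a2 a1"
  shows "excess b0 b1 b2 r =
    max (excess a0 a1 a2 r + (if r = 0 then 0 else min (b0 (r - 1)) (a1 r) - a1 r))
        (excess a0 a1 a2 (Suc r) + a1 (Suc r) - max (b0 r) (a1 (Suc r)))"
    and "excess a0 a1 a2 r + (if r = 0 then 0 else min (b0 (r - 1)) (a1 r) - a1 r)
       - (excess a0 a1 a2 (Suc r) + a1 (Suc r) - max (b0 r) (a1 (Suc r))) = b1 r - a2 (Suc r)"
proof -
  have s1: "(\<Sum>s\<le>r. b1 s) = (\<Sum>s\<le>r. a1 s) - (\<Sum>s\<le>r. a0 s) + (\<Sum>s<r. b0 s) + max (b0 r) (a1 (Suc r))"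
    unfolding b1_def by (rule sum_flip)
  have s2: "(\<Sum>s\<le>r. b2 s) = (\<Sum>s\<le>r. a2 s) - (\<Sum>s\<le>r. a1 s) + (\<Sum>s<r. b1 s) + max (b1 r) (a2 (Suc r))"
    unfolding b2_def by (rule sum_flip)
  have e: "excess b0 b1 b2 r = (\<Sum>s\<le>r. a2 s) - 2 * (\<Sum>s\<le>r. a1 s) + (\<Sum>s\<le>r. a0 s)
     + max (b1 r) (a2 (Suc r)) - max (b0 r) (a1 (Suc r))"
    using s1 s2 by (simp add: excess_def sum_subtractf)
  have b1r: "b1 r = (if r = 0 then a1 0 else min (b0 (r - 1)) (a1 r)) + max (b0 r) (a1 (Suc r)) - a0 r"
    by (simp add: b1_def flip_def)
  have e1: "excess a0 a1 a2 r = (\<Sum>s\<le>r. a2 s) - 2 * (\<Sum>s\<le>r. a1 s) + (\<Sum>s\<le>r. a0 s) + a1 r - a0 r"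
    by (simp add: excess_def sum_subtractf sum_atMost_eq)
  have e2: "excess a0 a1 a2 (Suc r) =
      (\<Sum>s\<le>r. a2 s) - 2 * (\<Sum>s\<le>r. a1 s) + (\<Sum>s\<le>r. a0 s) + a2 (Suc r) - a1 (Suc r)"
    by (simp add: excess_def sum_subtractf lessThan_Suc_atMost)
  show "excess b0 b1 b2 r =
    max (excess a0 a1 a2 r + (if r = 0 then 0 else min (b0 (r - 1)) (a1 r) - a1 r))
        (excess a0 a1 a2 (Suc r) + a1 (Suc r) - max (b0 r) (a1 (Suc r)))"
    unfolding e e1 e2 b1r by (cases "r = 0") (simp_all, linarith+)
  show "excess a0 a1 a2 r + (if r = 0 then 0 else min (b0 (r - 1)) (a1 r) - a1 r)
       - (excess a0 a1 a2 (Suc r) + a1 (Suc r) - max (b0 r) (a1 (Suc r))) = b1 r - a2 (Suc r)"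
    unfolding e1 e2 b1r by (cases "r = 0") auto
qed

text \<open>Row form of the intertwining with jeu de taquin: the maximal excess survives the slide,
  in row \<open>p\<close> or in the row above.\<close>

lemma raise_row_slide:
  fixes a0 a1 a2 b0 :: "nat \<Rightarrow> int"
  defines "b1 \<equiv> flip b0 a1 a0"
  defines "b2 \<equiv> flip b1 a2 a1"
  assumes p: "raise_row a0 a1 a2 p"
  obtains q where "raise_row b0 b1 b2 q"
    and "flip b0 (a1(p := a1 p + 1)) a0 = b1(q := b1 q + 1)"
    and "flip (b1(q := b1 q + 1)) a2 (a1(p := a1 p + 1)) = b2"
proof -
  let ?h = "excess a0 a1 a2"
  let ?k = "excess b0 b1 b2"
  let ?x = "\<lambda>r. ?h r + (if r = 0 then 0 else min (b0 (r - 1)) (a1 r) - a1 r)"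
  let ?y = "\<lambda>r. ?h (Suc r) + a1 (Suc r) - max (b0 r) (a1 (Suc r))"
  have k: "?k r = max (?x r) (?y r)" and xy: "?x r - ?y r = b1 r - a2 (Suc r)" for r
    unfolding b1_def b2_def by (rule excess_slide)+
  have h: "0 < ?h p" "\<And>s. s < p \<Longrightarrow> ?h s < ?h p" "\<And>s. ?h s \<le> ?h p"
    using p by (auto simp: raise_row_def)
  have x: "?x r \<le> ?h r" and y: "?y r \<le> ?h (Suc r)" for r by auto
  have kle: "?k r \<le> ?h p" for r
    using k[of r] x[of r] y[of r] h(3)[of r] h(3)[of "Suc r"] by linarith
  \<comment> \<open>The case decides which term of \<open>flip b0 a1 a0\<close> sees the increment
    of \<open>a1 p\<close>: the upper end in row \<open>p\<close>, or the maximum in row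
    \<open>p - 1\<close>.\<close>
  show thesis
  proof (cases "p = 0 \<or> a1 p < b0 (p - 1)")
    case True
    have xp: "?x p = ?h p" using True by auto
    then have kp: "?k p = ?h p" using k[of p] kle[of p] by linarith
    have less: "?k s < ?h p" if "s < p" for s
    proof -
      have "?y s < ?h p"
      proof (cases "Suc s = p")
        case True
        then show ?thesis using \<open>p = 0 \<or> a1 p < b0 (p - 1)\<close> by auto
      next
        case False
        then show ?thesis using y[of s] h(2)[of "Suc s"] that by linarith
      qed
      then show ?thesis using k[of s] x[of s] h(2)[OF that] by linarith
    qed
    \<comment> \<open>So the increment of \<open>b1 p\<close> enters the maximum in entry
      \<open>p\<close> of the second flip and cancels that of \<open>a1 p\<close>, while the minimum
      in entry \<open>Suc p\<close> stays \<open>a2 (Suc p)\<close>.\<close>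
    have c: "a2 (Suc p) \<le> b1 p" using xy[of p] xp k[of p] kp by linarith
    have e1: "flip b0 (a1(p := a1 p + 1)) a0 = b1(p := b1 p + 1)"
      using True unfolding b1_def by (auto simp: flip_def fun_eq_iff)
    have e2: "flip (b1(p := b1 p + 1)) a2 (a1(p := a1 p + 1)) = b2"
    proof
      fix r show "flip (b1(p := b1 p + 1)) a2 (a1(p := a1 p + 1)) r = b2 r"
        using c unfolding b2_def by (cases r) (auto simp: flip_def)
    qed
    show thesis
      by (rule that[OF _ e1 e2]) (use kp kle less h(1) in \<open>simp add: raise_row_def\<close>)
  next
    case False
    then obtain q where q: "p = Suc q" and ge: "b0 q \<le> a1 (Suc q)" by (cases p) auto
    have yq: "?y q = ?h p" using ge q by simp
    then have kq: "?k q = ?h p" using k[of q] kle[of q] by linarith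
    have less: "?k s < ?h p" if "s < q" for s
      using k[of s] x[of s] y[of s] h(2)[of s] h(2)[of "Suc s"] that q by linarith
    \<comment> \<open>Now the increment enters the minimum in entry \<open>Suc q\<close>, which is
      entry \<open>p\<close>, and cancels there.\<close>
    have c: "b1 q < a2 (Suc q)" using xy[of q] x[of q] yq h(2)[of q] q by simp
    have e1: "flip b0 (a1(p := a1 p + 1)) a0 = b1(q := b1 q + 1)"
      using ge unfolding q b1_def by (auto simp: flip_def fun_eq_iff)
    have e2: "flip (b1(q := b1 q + 1)) a2 (a1(p := a1 p + 1)) = b2"
      using c unfolding q b2_def by (auto simp: flip_def fun_eq_iff)
    show thesis
      by (rule that[OF _ e1 e2]) (use kq kle less h(1) in \<open>simp add: raise_row_def\<close>)
  qed
qed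

lemma excess_slide_pos:
  assumes "0 < excess b0 (flip b0 a1 a0) (flip (flip b0 a1 a0) a2 a1) r"
  shows "\<exists>r. 0 < excess a0 a1 a2 r"
proof (rule ccontr)
  assume "\<not> ?thesis"
  then have "excess a0 a1 a2 r \<le> 0" "excess a0 a1 a2 (Suc r) \<le> 0" by (auto simp: not_less)
  then show False using assms unfolding excess_slide(1) by (auto split: if_splits)
qed

lemma raise_row_unique: "raise_row a b c p \<Longrightarrow> raise_row a b c q \<Longrightarrow> p = q"
  unfolding raise_row_def by (metis less_le_not_le linorder_neqE_nat)

lemma excess_upd:
  "excess a (b(p := b p + 1)) c r = excess a b c r - (if r < p then 0 else if r = p then 1 else 2)"
proof -
  have "(\<Sum>s\<in>A. (b(p := b p + 1)) s) = (\<Sum>s\<in>A. b s) + (if p \<in> A then 1 else 0)" if "finite A" for A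
  proof -
    have "(\<Sum>s\<in>A. (b(p := b p + 1)) s) = (\<Sum>s\<in>A. b s + (if s = p then 1 else 0))"
      by (rule sum.cong) auto
    then show ?thesis using that by (simp add: sum.distrib)
  qed
  then show ?thesis by (simp add: excess_def sum_subtractf)
qed

text \<open>If \<open>p < q\<close>, compare the excess of the common result at \<open>p\<close> and
  \<open>q\<close>: the first preimage, maximal at \<open>p\<close>, makes it larger at
  \<open>p\<close>; the second, with first maximum at \<open>q\<close>, does not.\<close>

lemma raise_row_inj:
  assumes "raise_row a b c p" "raise_row a b' c q" "b(p := b p + 1) = b'(q := b' q + 1)"
  shows "p = q \<and> b = b'"
proof -
  have *: "\<not> p < q"
    if "raise_row a b c p" "raise_row a b' c q" "b(p := b p + 1) = b'(q := b' q + 1)" for b b' p q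
  proof
    assume "p < q"
    let ?d = "excess a (b(p := b p + 1)) c"
    have "excess a b c q \<le> excess a b c p" "excess a b' c p < excess a b' c q"
      using that(1,2) \<open>p < q\<close> by (auto simp: raise_row_def)
    moreover have "?d p = excess a b c p - 1" "?d q = excess a b c q - 2"
      using \<open>p < q\<close> by (auto simp: excess_upd)
    moreover have "?d p = excess a b' c p" "?d q = excess a b' c q - 1"
      using \<open>p < q\<close> unfolding that(3) by (auto simp: excess_upd)
    ultimately show False by linarith
  qed
  have "p = q" using *[OF assms] *[OF assms(2,1) assms(3)[symmetric]] by simp
  moreover have "b = b'"
    using assms(3) \<open>p = q\<close> by (auto simp: fun_eq_iff fun_upd_def split: if_splits)
  ultimately show ?thesis ..
qed

section \<open>Toggles and raising operators on patterns\<close>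

text \<open>Level \<open>m\<close> of a pattern is a partition, its parts indexed from 0; the levels need not stabilise.\<close>

type_synonym pattern = "nat \<Rightarrow> nat \<Rightarrow> int"

text \<open>Gelfand-Tsetlin patterns without a top level. Interlacing upwards from the zero level
  forces non-negative parts, at most \<open>m\<close> of them non-zero on level
  \<open>m\<close>.\<close>

definition patterns :: "pattern set" where
  "patterns = {g. (\<forall>r. g 0 r = 0) \<and> (\<forall>m r. g m r \<le> g (Suc m) r) \<and> (\<forall>m r. g (Suc m) (Suc r) \<le> g m r)}"

definition toggle :: "nat \<Rightarrow> pattern \<Rightarrow> pattern" where
  "toggle i g = g(i := flip (g (i - 1)) (g (Suc i)) (g i))"

primrec toggle_desc :: "nat \<Rightarrow> pattern \<Rightarrow> pattern" where
  "toggle_desc 0 = id"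
| "toggle_desc (Suc m) = toggle (Suc m) \<circ> toggle_desc m"

primrec toggle_asc :: "nat \<Rightarrow> pattern \<Rightarrow> pattern" where
  "toggle_asc 0 = id"
| "toggle_asc (Suc m) = toggle_asc m \<circ> toggle (Suc m)"

primrec toggle_q :: "nat \<Rightarrow> pattern \<Rightarrow> pattern" where
  "toggle_q 0 = id"
| "toggle_q (Suc m) = toggle_q m \<circ> toggle_desc (Suc m)"

text \<open>The factor \<open>P\<close> left of \<open>toggle_q (n + s)\<close> once
  \<open>toggle_q n\<close> is split off.\<close>

primrec promote :: "nat \<Rightarrow> nat \<Rightarrow> pattern \<Rightarrow> pattern" where
  "promote n 0 = id"
| "promote n (Suc s) = promote n s \<circ> toggle_desc (Suc (n + s))"

primrec unpromote :: "nat \<Rightarrow> nat \<Rightarrow> pattern \<Rightarrow> pattern" where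
  "unpromote n 0 = id"
| "unpromote n (Suc s) = toggle_asc (Suc (n + s)) \<circ> unpromote n s"

text \<open>A relation because the operator is partial: an equivalence of two instances then also
  says that both sides are defined together.\<close>

definition raise :: "nat \<Rightarrow> pattern \<Rightarrow> pattern \<Rightarrow> bool" where
  "raise l g g' \<longleftrightarrow> (\<exists>p. raise_row (g (l - 1)) (g l) (g (Suc l)) p \<and> g' = g(l := (g l)(p := g l p + 1)))"

section \<open>Products of toggles and their inverses\<close>

lemma toggle_toggle: "1 \<le> i \<Longrightarrow> toggle i (toggle i g) = g"
  by (cases i) (simp_all add: toggle_def flip_flip)

lemma toggle_commute:
  assumes "1 \<le> i" "i + 1 < j"
  shows "toggle i (toggle j g) = toggle j (toggle i g)"
proof -
  have "j - 1 \<noteq> i" "Suc i \<noteq> j" "i \<noteq> j" "Suc j \<noteq> i" "i - 1 \<noteq> j" using assms by auto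
  then show ?thesis by (auto simp: toggle_def fun_upd_twist)
qed

lemma toggle_desc_asc: "toggle_desc m (toggle_asc m g) = g"
  by (induction m arbitrary: g) (simp_all add: toggle_toggle)

lemma toggle_asc_desc: "toggle_asc m (toggle_desc m g) = g"
  by (induction m arbitrary: g) (simp_all add: toggle_toggle)

lemma promote_unpromote: "promote n s (unpromote n s g) = g"
  by (induction s arbitrary: g) (simp_all add: toggle_desc_asc del: toggle_desc.simps toggle_asc.simps)

lemma unpromote_promote: "unpromote n s (promote n s g) = g"
  by (induction s arbitrary: g) (simp_all add: toggle_asc_desc del: toggle_desc.simps toggle_asc.simps)

lemma toggle_q_toggle_commute:
  assumes "Suc m < i"
  shows "toggle i (toggle_q m g) = toggle_q m (toggle i g)"
proof -
  have d: "toggle i (toggle_desc m g) = toggle_desc m (toggle i g)" if "Suc m < i" for m g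
    using that
  proof (induction m arbitrary: g)
    case (Suc m)
    then show ?case using toggle_commute[of "Suc m" i "toggle_desc m g"] by simp
  qed simp
  show ?thesis
    using assms by (induction m arbitrary: g) (simp_all add: d del: toggle_desc.simps)
qed

text \<open>Peels a factor off on the left instead of the right; the top toggle can move there
  because it commutes with the shorter product. Comparing the two recursions shows that
  \<open>toggle_q m\<close> is an involution.\<close>

lemma toggle_q_Suc: "toggle_q (Suc m) g = toggle_asc (Suc m) (toggle_q m g)"
proof (induction m arbitrary: g)
  case (Suc m)
  have "toggle_q (Suc (Suc m)) g = toggle_q (Suc m) (toggle (Suc (Suc m)) (toggle_desc (Suc m) g))"
    by simp
  also have "\<dots> = toggle_asc (Suc m) (toggle_q m (toggle (Suc (Suc m)) (toggle_desc (Suc m) g)))"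
    by (rule Suc)
  also have "\<dots> = toggle_asc (Suc m) (toggle (Suc (Suc m)) (toggle_q m (toggle_desc (Suc m) g)))"
    by (simp only: toggle_q_toggle_commute[OF lessI])
  also have "\<dots> = toggle_asc (Suc (Suc m)) (toggle_q (Suc m) g)"
    by (simp only: toggle_asc.simps(2)[of "Suc m"] toggle_q.simps(2) comp_apply)
  finally show ?case .
qed simp

lemma toggle_q_toggle_q: "toggle_q m (toggle_q m g) = g"
proof (induction m arbitrary: g)
  case (Suc m)
  have "toggle_q (Suc m) (toggle_q (Suc m) g) = toggle_asc (Suc m) (toggle_q m (toggle_q m (toggle_desc (Suc m) g)))"
    unfolding toggle_q_Suc[of m "toggle_q (Suc m) g"] by simp
  then show ?case by (simp add: Suc toggle_asc_desc del: toggle_desc.simps toggle_asc.simps)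
qed simp

lemma toggle_q_add: "toggle_q (n + s) g = toggle_q n (promote n s g)"
  by (induction s arbitrary: g) (simp_all del: toggle_desc.simps)

text \<open>With \<open>q = toggle_q n\<close>, the long product is \<open>q P\<close> and, being an
  involution, also the inverse of \<open>P\<close> times \<open>q\<close>; the three copies of
  \<open>q\<close> collapse to one.\<close>

lemma toggle_q_conj:
  "toggle_q (n + s) (toggle_q n (toggle_q (n + s) g)) = unpromote n s (toggle_q n (promote n s g))"
proof -
  have "toggle_q (n + s) h = unpromote n s (toggle_q n h)" for h
    by (metis toggle_q_add toggle_q_toggle_q unpromote_promote)
  from this[of "toggle_q n (toggle_q (n + s) g)"] show ?thesis
    by (simp only: toggle_q_toggle_q) (simp only: toggle_q_add)
qed

section \<open>Interlacing, and the levels that toggles read and change\<close>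

lemma patternsD:
  assumes "g \<in> patterns"
  shows "g 0 r = 0" "g m r \<le> g (Suc m) r" "g (Suc m) (Suc r) \<le> g m r"
  using assms by (auto simp: patterns_def)

lemma pattern_zero:
  assumes g: "g \<in> patterns" and "m \<le> r"
  shows "g m r = 0"
proof -
  have ge: "0 \<le> g m r" for m r
    by (induction m) (use patternsD[OF g] in \<open>auto intro: order_trans\<close>)
  have "m \<le> r \<Longrightarrow> g m r \<le> 0"
  proof (induction m arbitrary: r)
    case (Suc m)
    then obtain r' where "r = Suc r'" by (cases r) auto
    then show ?case using Suc patternsD(3)[OF g, of m r'] by fastforce
  qed (use patternsD(1)[OF g] in simp)
  then show ?thesis using ge[of m r] assms(2) by simp
qed

lemma pattern_mono: "g \<in> patterns \<Longrightarrow> m \<le> n \<Longrightarrow> g m r \<le> g n r"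
  using patternsD(2) lift_Suc_mono_le[of "\<lambda>m. g m r"] by blast

text \<open>The interlacing bounds are the ends of the interval of reflection, so the reflected
  entries stay within them.\<close>

lemma toggle_patterns:
  assumes g: "g \<in> patterns" and i: "1 \<le> i"
  shows "toggle i g \<in> patterns"
proof -
  obtain i' where i': "i = Suc i'" using i by (cases i) auto
  note D = patternsD[OF g]
  let ?f = "flip (g i') (g (Suc i)) (g i)"
  have "g i' r \<le> ?f r" for r
    using D(2)[of i' r] D(2)[of i r] D(3)[of i' "r - 1"] i'
    by (auto simp: flip_def not_le min_def max_def)
  moreover have "?f r \<le> g (Suc i) r" for r
    using D(2)[of i' r] D(2)[of i r] D(3)[of i r] i'
    by (auto simp: flip_def not_le min_def max_def)
  moreover have "?f (Suc r) \<le> g i' r" for r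
    using D(2)[of i' "Suc r"] D(3)[of i "Suc r"] i'
    by (auto simp: flip_def not_le min_def max_def)
  moreover have "g (Suc i) (Suc r) \<le> ?f r" for r
    using D(2)[of i r] D(3)[of i' "r - 1"] i'
    by (auto simp: flip_def not_le min_def max_def)
  ultimately show ?thesis
    using D i' by (auto simp: patterns_def toggle_def)
qed

lemma toggle_desc_patterns: "g \<in> patterns \<Longrightarrow> toggle_desc m g \<in> patterns"
  by (induction m) (simp_all add: toggle_patterns)

lemma toggle_asc_patterns: "g \<in> patterns \<Longrightarrow> toggle_asc m g \<in> patterns"
  by (induction m arbitrary: g) (simp_all add: toggle_patterns)

lemma toggle_q_patterns: "g \<in> patterns \<Longrightarrow> toggle_q m g \<in> patterns"
  by (induction m arbitrary: g) (auto intro: toggle_desc_patterns simp del: toggle_desc.simps)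

lemma promote_patterns: "g \<in> patterns \<Longrightarrow> promote n s g \<in> patterns"
  by (induction s arbitrary: g) (auto intro: toggle_desc_patterns simp del: toggle_desc.simps)

lemma unpromote_patterns: "g \<in> patterns \<Longrightarrow> unpromote n s g \<in> patterns"
  by (induction s arbitrary: g) (auto intro: toggle_asc_patterns simp del: toggle_asc.simps)

lemma toggle_q_cong:
  assumes "\<And>m. m \<le> Suc n \<Longrightarrow> g m = h m" and "m \<le> Suc n"
  shows "toggle_q n g m = toggle_q n h m"
proof -
  have "k \<le> n \<Longrightarrow> (\<And>m. m \<le> Suc n \<Longrightarrow> g m = h m) \<Longrightarrow> \<forall>m\<le>Suc n. toggle_q k g m = toggle_q k h m"
    for k g h
  proof (induction k arbitrary: g h)
    case (Suc k)
    have c: "\<forall>m\<le>Suc n. toggle_desc l g m = toggle_desc l h m" if "l \<le> n" for l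
      using that by (induction l) (use Suc.prems(2) in \<open>simp_all add: toggle_def\<close>)
    show ?case using Suc.IH[of "toggle_desc (Suc k) g" "toggle_desc (Suc k) h"] c[of "Suc k"] Suc.prems(1)
      by (simp del: toggle_desc.simps)
  qed simp
  then show ?thesis using assms by blast
qed

lemma toggle_desc_above: "n < m \<Longrightarrow> toggle_desc n g m = g m"
  by (induction n) (simp_all add: toggle_def)

lemma toggle_q_above: "n < m \<Longrightarrow> toggle_q n g m = g m"
  by (induction n arbitrary: g) (simp_all add: toggle_desc_above del: toggle_desc.simps)

section \<open>Raising operators against toggles\<close>

lemma raise_toggle:
  assumes r: "raise l g g'" and i: "1 \<le> i" and far: "i + 1 < l \<or> l + 1 < i"
  shows "raise l (toggle i g) (toggle i g')"
proof -
  obtain p where p: "raise_row (g (l - 1)) (g l) (g (Suc l)) p"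
    and g': "g' = g(l := (g l)(p := g l p + 1))"
    using r by (auto simp: raise_def)
  \<comment> \<open>Each operation changes one level and reads only that level and its two
    neighbours; at distance at least 2 neither changes what the other reads.\<close>
  have ne: "i \<noteq> l" "i - 1 \<noteq> l" "Suc i \<noteq> l" "l - 1 \<noteq> i" "Suc l \<noteq> i" using far i by auto
  show ?thesis unfolding raise_def
    by (rule exI[of _ p]) (use p ne in \<open>simp add: g' toggle_def fun_upd_twist\<close>)
qed

lemma raise_toggle_iff:
  assumes "1 \<le> i" "i + 1 < l \<or> l + 1 < i"
  shows "raise l (toggle i g) (toggle i g') \<longleftrightarrow> raise l g g'"
  using raise_toggle[OF _ assms, of g g'] raise_toggle[OF _ assms, of "toggle i g" "toggle i g'"]
    toggle_toggle[OF assms(1)] by auto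

lemma toggle_toggle_Suc:
  assumes "1 \<le> l"
  shows "toggle (Suc l) (toggle l g) =
    g(l := flip (g (l - 1)) (g (Suc l)) (g l),
      Suc l := flip (flip (g (l - 1)) (g (Suc l)) (g l)) (g (Suc (Suc l))) (g (Suc l)))"
  by (simp add: toggle_def)

lemma raise_slide:
  assumes "raise (Suc l) g g'" and "1 \<le> l"
  shows "raise l (toggle (Suc l) (toggle l g)) (toggle (Suc l) (toggle l g'))"
proof -
  let ?b0 = "g (l - 1)" and ?a0 = "g l" and ?a1 = "g (Suc l)" and ?a2 = "g (Suc (Suc l))"
  let ?b1 = "flip ?b0 ?a1 ?a0"
  let ?b2 = "flip ?b1 ?a2 ?a1"
  obtain p where p: "raise_row ?a0 ?a1 ?a2 p" and g': "g' = g(Suc l := ?a1(p := ?a1 p + 1))"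
    using assms(1) by (auto simp: raise_def)
  obtain q where q: "raise_row ?b0 ?b1 ?b2 q"
    "flip ?b0 (?a1(p := ?a1 p + 1)) ?a0 = ?b1(q := ?b1 q + 1)"
    "flip (?b1(q := ?b1 q + 1)) ?a2 (?a1(p := ?a1 p + 1)) = ?b2"
    by (rule raise_row_slide[OF p])
  have t: "toggle (Suc l) (toggle l g) = g(l := ?b1, Suc l := ?b2)"
    by (rule toggle_toggle_Suc[OF assms(2)])
  have ne: "l - 1 \<noteq> l" "l - 1 \<noteq> Suc l" using assms(2) by auto
  have g'_at: "g' (l - 1) = ?b0" "g' l = ?a0" "g' (Suc l) = ?a1(p := ?a1 p + 1)" "g' (Suc (Suc l)) = ?a2"
    using ne by (simp_all add: g')
  have t': "toggle (Suc l) (toggle l g') = g(l := ?b1(q := ?b1 q + 1), Suc l := ?b2)"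
    unfolding toggle_toggle_Suc[OF assms(2), of g'] g'_at q unfolding g' by (simp add: fun_upd_twist)
  show ?thesis unfolding raise_def t t'
    by (rule exI[of _ q]) (use q(1) ne in \<open>simp add: fun_upd_twist\<close>)
qed

text \<open>From row \<open>l\<close> on the excess decreases weakly, so its maximum over all rows
  is attained among rows 0 to \<open>l\<close>; the first such row is raised.\<close>

lemma raise_exists:
  assumes g: "g \<in> patterns" and l: "1 \<le> l" and r: "0 < excess (g (l - 1)) (g l) (g (Suc l)) r"
  shows "\<exists>g'. raise l g g'"
proof -
  let ?h = "excess (g (l - 1)) (g l) (g (Suc l))"
  have step: "?h (Suc r) \<le> ?h r" if "l < Suc r" for r
    using that pattern_zero[OF g] l patternsD(2)[OF g, of "l - 1" r] by (simp add: excess_def)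
  have tail: "?h r \<le> ?h l" if "l \<le> r" for r
    using that
  proof (induction r rule: dec_induct)
    case (step r)
    then show ?case using \<open>l < Suc r \<Longrightarrow> ?h (Suc r) \<le> ?h r\<close> by simp
  qed simp
  define M where "M = Max (?h ` {..l})"
  have M: "?h r \<le> M" for r
  proof (cases "r \<le> l")
    case False
    then have "?h r \<le> ?h l" using tail by simp
    also have "\<dots> \<le> M" by (simp add: M_def)
    finally show ?thesis .
  qed (simp add: M_def)
  have "M \<in> ?h ` {..l}" unfolding M_def by (rule Max_in) auto
  then have "\<exists>r. ?h r = M" by blast
  then obtain p where p: "?h p = M" "\<forall>s<p. ?h s \<noteq> M"
    using exists_least_iff[of "\<lambda>r. ?h r = M"] by blast
  have "raise_row (g (l - 1)) (g l) (g (Suc l)) p"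
    unfolding raise_row_def p(1) using p(2) M r by (metis less_le_trans order_less_le)
  then show ?thesis by (auto simp: raise_def)
qed

text \<open>There is room in the raised row: positive excess in row 0, or the strict increase from
  row \<open>p - 1\<close> to row \<open>p\<close>, makes the two interlacing bounds strict
  there.\<close>

lemma raise_patterns:
  assumes g: "g \<in> patterns" and l: "1 \<le> l" and r: "raise l g g'"
  shows "g' \<in> patterns"
proof -
  obtain p where p: "raise_row (g (l - 1)) (g l) (g (Suc l)) p"
    and g': "g' = g(l := (g l)(p := g l p + 1))"
    using r by (auto simp: raise_def)
  obtain l' where l': "l = Suc l'" using l by (cases l) auto
  note D = patternsD[OF g]
  have "g l p < g (Suc l) p \<and> (p = 0 \<or> g l p < g l' (p - 1))"
  proof (cases p)
    case 0
    then show ?thesis using p by (simp add: raise_row_def excess_def)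
  next
    case (Suc s)
    have "excess (g l') (g l) (g (Suc l)) s < excess (g l') (g l) (g (Suc l)) p"
      using p Suc l' by (simp add: raise_row_def)
    then have "g l s - g l' s < g (Suc l) p - g l p"
      using Suc by (simp add: excess_def sum_subtractf lessThan_Suc_atMost sum_atMost_eq)
    then show ?thesis using D(2)[of l' s] D(3)[of l s] l' Suc by auto
  qed
  then have up: "g l r + (if r = p then 1 else 0) \<le> g (Suc l) r"
    and left: "g l (Suc r) + (if Suc r = p then 1 else 0) \<le> g l' r" for r
    using D(2)[of l r] D(3)[of l' r] l' by auto
  have g'_l: "m = l \<Longrightarrow> g' m r = g l r + (if r = p then 1 else 0)" for m r by (simp add: g')
  have g'_ne: "m \<noteq> l \<Longrightarrow> g' m r = g m r" for m r by (simp add: g')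
  have "g' m r \<le> g' (Suc m) r" for m r
    by (cases "m = l"; cases "Suc m = l") (use up[of r] D(2)[of m r] in \<open>auto simp: g'_l g'_ne\<close>)
  moreover have "g' (Suc m) (Suc r) \<le> g' m r" for m r
    by (cases "m = l"; cases "Suc m = l") (use left[of r] D(3)[of m r] l' in \<open>auto simp: g'_l g'_ne\<close>)
  ultimately show ?thesis using D(1) l' by (simp add: patterns_def g'_ne)
qed

lemma raise_functional: "raise l g h \<Longrightarrow> raise l g h' \<Longrightarrow> h = h'"
  unfolding raise_def using raise_row_unique by blast

text \<open>Conversely, the slide creates no positive excess, so the operator was already defined
  before it; uniqueness of the result and invertibility of the toggles finish.\<close>

lemma raise_slide_iff:
  assumes g: "g \<in> patterns" and l: "1 \<le> l"
  shows "raise l (toggle (Suc l) (toggle l g)) (toggle (Suc l) (toggle l g')) \<longleftrightarrow> raise (Suc l) g g'"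
proof
  assume r: "raise l (toggle (Suc l) (toggle l g)) (toggle (Suc l) (toggle l g'))"
  then obtain q where "0 < excess (g (l - 1)) (flip (g (l - 1)) (g (Suc l)) (g l))
      (flip (flip (g (l - 1)) (g (Suc l)) (g l)) (g (Suc (Suc l))) (g (Suc l))) q"
    using l unfolding raise_def raise_row_def toggle_toggle_Suc[OF l] by (cases l) auto
  then obtain h where h: "raise (Suc l) g h"
    using raise_exists[OF g, of "Suc l"] excess_slide_pos by (metis diff_Suc_1 le_add1 plus_1_eq_Suc)
  have "toggle (Suc l) (toggle l h) = toggle (Suc l) (toggle l g')"
    using raise_functional[OF raise_slide[OF h l] r] .
  then have "h = g'" using toggle_toggle[OF l] toggle_toggle[of "Suc l"] by (metis le_add1 plus_1_eq_Suc)
  then show "raise (Suc l) g g'" using h by simp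
qed (rule raise_slide[OF _ l])

lemma raise_other: "raise l g g' \<Longrightarrow> m \<noteq> l \<Longrightarrow> g' m = g m"
  by (auto simp: raise_def)

text \<open>Injectivity of the raising operator, in a form that ignores the levels above
  \<open>Suc n\<close>.\<close>

lemma raise_agree_below:
  assumes "raise l g g'" "raise l h h'" "1 \<le> l" "l \<le> n"
    and "\<And>m. m \<le> Suc n \<Longrightarrow> g' m = h' m" and "m \<le> Suc n"
  shows "g m = h m"
proof (cases "m = l")
  case False
  then show ?thesis using assms raise_other by metis
next
  case True
  have ne: "l - 1 \<noteq> l" using assms(3) by simp
  have n: "g' (l - 1) = h' (l - 1)" "g' l = h' l" "g' (Suc l) = h' (Suc l)"
    using assms(3-5) by auto
  obtain p where p: "raise_row (g (l - 1)) (g l) (g (Suc l)) p" "g' = g(l := (g l)(p := g l p + 1))"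
    using assms(1) by (auto simp: raise_def)
  obtain q where q: "raise_row (h (l - 1)) (h l) (h (Suc l)) q" "h' = h(l := (h l)(q := h l q + 1))"
    using assms(2) by (auto simp: raise_def)
  have "h (l - 1) = g (l - 1)" "h (Suc l) = g (Suc l)" "(g l)(p := g l p + 1) = (h l)(q := h l q + 1)"
    using n p(2) q(2) ne by auto
  then show ?thesis using raise_row_inj p(1) q(1) True by metis
qed

inductive raises :: "nat list \<Rightarrow> pattern \<Rightarrow> pattern \<Rightarrow> bool" where
  Nil: "raises [] g g"
| Cons: "raise l g h \<Longrightarrow> raises w h g' \<Longrightarrow> raises (l # w) g g'"

inductive_cases raises_NilE: "raises [] g g'"
inductive_cases raises_ConsE: "raises (l # w) g g'"

lemma raises_other: "raises w g g' \<Longrightarrow> m \<notin> set w \<Longrightarrow> g' m = g m"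
  by (induction rule: raises.induct) (auto dest: raise_other)

lemma raises_agree_below:
  assumes "raises w g g'" "raises w h h'" "set w \<subseteq> {1..n}"
    and "\<And>m. m \<le> Suc n \<Longrightarrow> g' m = h' m" and "m \<le> Suc n"
  shows "g m = h m"
  using assms
proof (induction arbitrary: h m rule: raises.induct)
  case (Nil g)
  then show ?case by (auto elim: raises_NilE)
next
  case (Cons l g f w g')
  obtain f' where f': "raise l h f'" "raises w f' h'" using Cons.prems(1) by (rule raises_ConsE)
  have "f m = f' m" if "m \<le> Suc n" for m
    by (rule Cons.IH[OF f'(2)]) (use Cons.prems that in auto)
  then show ?case
    using raise_agree_below[OF Cons.hyps(1) f'(1), of n m] Cons.prems by auto
qed

lemma raises_map:
  assumes "raises w g g'" and "g \<in> patterns" and "set w \<subseteq> {1..}"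
    and "\<And>l g h. l \<in> set w \<Longrightarrow> g \<in> patterns \<Longrightarrow> h \<in> patterns \<Longrightarrow> raise l g h \<Longrightarrow> raise (\<phi> l) (f g) (f h)"
  shows "raises (map \<phi> w) (f g) (f g')"
  using assms
proof (induction rule: raises.induct)
  case (Cons l g h w g')
  have h: "h \<in> patterns" using Cons.prems Cons.hyps raise_patterns by auto
  have "raise (\<phi> l) (f g) (f h)" using Cons.prems Cons.hyps h by auto
  moreover have "raises (map \<phi> w) (f h) (f g')" using Cons.IH Cons.prems h by auto
  ultimately show ?case by (auto intro: raises.Cons)
qed (simp add: raises.Nil)

text \<open>Toggles below \<open>l\<close> commute with raising at \<open>Suc l\<close>, the pair at
  \<open>l\<close> and \<open>Suc l\<close> lowers the index to \<open>l\<close>, and the later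
  toggles commute with raising at \<open>l\<close>.\<close>

lemma raise_toggle_desc_iff:
  assumes g: "g \<in> patterns" and l: "1 \<le> l" "l < n"
  shows "raise l (toggle_desc n g) (toggle_desc n g') \<longleftrightarrow> raise (Suc l) g g'"
proof -
  have low: "raise (Suc l) (toggle_desc k g) (toggle_desc k g') \<longleftrightarrow> raise (Suc l) g g'" if "k < l" for k
    using that by (induction k) (simp_all add: raise_toggle_iff)
  have "raise l (toggle_desc (Suc l + k) g) (toggle_desc (Suc l + k) g') \<longleftrightarrow> raise (Suc l) g g'" for k
  proof (induction k)
    case 0
    obtain l' where l': "l = Suc l'" using l by (cases l) auto
    have "raise l (toggle (Suc l) (toggle l (toggle_desc l' g))) (toggle (Suc l) (toggle l (toggle_desc l' g')))
       \<longleftrightarrow> raise (Suc l) (toggle_desc l' g) (toggle_desc l' g')"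
      by (rule raise_slide_iff[OF toggle_desc_patterns[OF g] l(1)])
    then show ?case using low[of l'] by (simp add: l')
  next
    case (Suc k)
    then show ?case by (simp add: raise_toggle_iff)
  qed
  from this[of "n - Suc l"] show ?thesis using l by simp
qed

lemma raise_promote_iff:
  assumes "g \<in> patterns" "1 \<le> l" "l \<le> n"
  shows "raise l (promote n s g) (promote n s g') \<longleftrightarrow> raise (l + s) g g'"
  using assms(1)
proof (induction s arbitrary: g g')
  case (Suc s)
  have "raise l (promote n (Suc s) g) (promote n (Suc s) g') \<longleftrightarrow>
      raise (l + s) (toggle_desc (Suc (n + s)) g) (toggle_desc (Suc (n + s)) g')"
    using Suc.IH[OF toggle_desc_patterns[OF Suc.prems]] by (simp del: toggle_desc.simps)
  also have "\<dots> \<longleftrightarrow> raise (Suc (l + s)) g g'"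
    by (rule raise_toggle_desc_iff) (use assms Suc.prems in auto)
  finally show ?case by simp
qed simp

section \<open>Level sizes and content\<close>

definition level_size :: "nat \<Rightarrow> pattern \<Rightarrow> int" where
  "level_size m g = (\<Sum>r<m. g m r)"

lemma level_size_eq: "g \<in> patterns \<Longrightarrow> m \<le> k \<Longrightarrow> (\<Sum>r<k. g m r) = level_size m g"
  unfolding level_size_def by (rule sum.mono_neutral_right) (auto simp: pattern_zero)

lemma level_size_toggle:
  assumes g: "g \<in> patterns" and i: "1 \<le> i"
  shows "level_size i (toggle i g) = level_size (i - 1) g + level_size (Suc i) g - level_size i g"
proof -
  have "level_size i (toggle i g) = (\<Sum>s\<le>i. toggle i g i s)"
    using level_size_eq[OF toggle_patterns[OF g i], of i "Suc i"] by (simp add: lessThan_Suc_atMost)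
  also have "\<dots> = (\<Sum>s\<le>i. g (Suc i) s) - (\<Sum>s\<le>i. g i s) + (\<Sum>s<i. g (i - 1) s) + max (g (i - 1) i) (g (Suc i) (Suc i))"
    using sum_flip by (simp add: toggle_def)
  also have "(\<Sum>s\<le>i. g (Suc i) s) = level_size (Suc i) g"
    by (simp add: level_size_def lessThan_Suc_atMost)
  also have "(\<Sum>s\<le>i. g i s) = level_size i g"
    using level_size_eq[OF g, of i "Suc i"] by (simp add: lessThan_Suc_atMost)
  also have "(\<Sum>s<i. g (i - 1) s) = level_size (i - 1) g"
    by (rule level_size_eq[OF g]) simp
  finally show ?thesis using pattern_zero[OF g] by simp
qed

lemma level_size_toggle_other: "m \<noteq> i \<Longrightarrow> level_size m (toggle i g) = level_size m g"
  by (simp add: level_size_def toggle_def)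

text \<open>On content, the letters 2 to \<open>n + 1\<close> become the letters 1 to
  \<open>n\<close>.\<close>

lemma level_size_toggle_desc:
  assumes g: "g \<in> patterns"
  shows "m \<le> n \<Longrightarrow> level_size m (toggle_desc n g) = level_size (Suc m) g - level_size 1 g"
proof (induction n arbitrary: m)
  case 0
  then show ?case by (simp add: level_size_def patternsD(1)[OF g])
next
  case (Suc n)
  show ?case
  proof (cases "m = Suc n")
    case True
    have "level_size m (toggle_desc (Suc n) g) = level_size n (toggle_desc n g) + level_size (Suc m) (toggle_desc n g)
      - level_size m (toggle_desc n g)"
      using True level_size_toggle[OF toggle_desc_patterns[OF g], of m n] by simp
    moreover have "level_size k (toggle_desc n g) = level_size k g" if "n < k" for k
      using that by (simp add: level_size_def toggle_desc_above)
    ultimately show ?thesis using Suc.IH[of n] True by simp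
  next
    case False
    then show ?thesis using Suc by (simp add: level_size_toggle_other)
  qed
qed

text \<open>Only the letters after \<open>s\<close> are counted, so a toggle below level
  \<open>s\<close> cannot affect these sizes.\<close>

lemma level_size_promote:
  assumes "g \<in> patterns" and "m \<le> Suc n"
  shows "level_size m (promote n s g) = level_size (m + s) g - level_size s g"
  using assms(1)
proof (induction s arbitrary: g)
  case 0
  then show ?case by (simp add: level_size_def)
next
  case (Suc s)
  let ?g = "toggle_desc (Suc (n + s)) g"
  have "level_size m (promote n (Suc s) g) = level_size (m + s) ?g - level_size s ?g"
    using Suc.IH[OF toggle_desc_patterns[OF Suc.prems]] by (simp del: toggle_desc.simps)
  then show ?case
    using level_size_toggle_desc[OF Suc.prems, of "m + s" "Suc (n + s)"]
      level_size_toggle_desc[OF Suc.prems, of s "Suc (n + s)"] assms(2) by (simp del: toggle_desc.simps)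
qed

section \<open>Highest weight patterns\<close>

definition highest :: "nat \<Rightarrow> pattern \<Rightarrow> bool" where
  "highest n g \<longleftrightarrow> (\<forall>l\<in>{1..n}. \<nexists>g'. raise l g g')"

text \<open>Once the earlier rows are constant, the excess in row \<open>r\<close> is
  \<open>g (Suc l) r - g l r\<close>: not positive by highest weight, not negative by
  interlacing.\<close>

lemma highest_eq:
  assumes g: "g \<in> patterns" and h: "highest n g"
  shows "r < l \<Longrightarrow> l \<le> n \<Longrightarrow> g l r = g (Suc l) r"
proof (induction r arbitrary: l rule: less_induct)
  case (less r)
  have "excess (g (l - 1)) (g l) (g (Suc l)) r \<le> 0"
    using raise_exists[OF g, of l r] h less.prems by (force simp: highest_def not_less)
  moreover have "g l s = g (Suc l) s" "g l s = g (l - 1) s" if "s < r" for s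
    using less.IH[OF that, of l] less.IH[OF that, of "l - 1"] that less.prems by auto
  then have "excess (g (l - 1)) (g l) (g (Suc l)) r = g (Suc l) r - g l r"
    by (simp add: excess_def sum_atMost_eq)
  ultimately show ?case using patternsD(2)[OF g, of l r] by simp
qed

text \<open>Going up one level adds a single new part, and the level sizes determine it.\<close>

lemma highest_unique_size:
  assumes g: "g \<in> patterns" "highest n g" and h: "h \<in> patterns" "highest n h"
    and eq: "\<And>m. m \<le> Suc n \<Longrightarrow> level_size m g = level_size m h"
  shows "m \<le> Suc n \<Longrightarrow> g m = h m"
proof (induction m)
  case 0
  then show ?case by (simp add: fun_eq_iff patternsD(1)[OF g(1)] patternsD(1)[OF h(1)])
next
  case (Suc m)
  have top: "f (Suc m) m = level_size (Suc m) f - level_size m f" if "f \<in> patterns" "highest n f" for f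
  proof -
    have "(\<Sum>r<m. f (Suc m) r) = level_size m f"
      unfolding level_size_def by (rule sum.cong) (use highest_eq[OF that] Suc.prems in auto)
    then show ?thesis by (simp add: level_size_def)
  qed
  show ?case
  proof
    fix r
    consider "r < m" | "r = m" | "Suc m \<le> r" by linarith
    then show "g (Suc m) r = h (Suc m) r"
    proof cases
      case 1
      then show ?thesis using highest_eq[OF g, of r m] highest_eq[OF h, of r m] Suc by simp
    next
      case 2
      then show ?thesis using top[OF g] top[OF h] eq Suc.prems by simp
    next
      case 3
      then show ?thesis using pattern_zero g(1) h(1) by metis
    qed
  qed
qed

lemma highest_unique_top:
  assumes g: "g \<in> patterns" "highest n g" and h: "h \<in> patterns" "highest n h"
    and eq: "g (Suc n) = h (Suc n)" and "m \<le> Suc n"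
  shows "g m = h m"
  using \<open>m \<le> Suc n\<close>
proof (induction m rule: inc_induct)
  case (step m)
  show ?case
  proof
    fix r show "g m r = h m r"
      using highest_eq[OF g, of r m] highest_eq[OF h, of r m] step
        pattern_zero[OF g(1), of m r] pattern_zero[OF h(1), of m r]
      by (cases "r < m") (auto simp: not_less)
  qed
qed (rule eq)

lemma raises_highest:
  assumes "g \<in> patterns"
  shows "\<exists>w g'. set w \<subseteq> {1..n} \<and> raises w g g' \<and> g' \<in> patterns \<and> highest n g'"
  using assms
\<comment> \<open>Raising increases an entry on a level up to \<open>n\<close>, while level
  \<open>Suc n\<close> is fixed and bounds these entries, so this measure drops.\<close>
proof (induction "nat (\<Sum>l\<in>{1..n}. \<Sum>r<n. g (Suc n) r - g l r)" arbitrary: g rule: less_induct)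
  case less
  show ?case
  proof (cases "highest n g")
    case True
    then show ?thesis using less.prems by (intro exI[of _ "[]"] exI[of _ g]) (auto intro: raises.Nil)
  next
    case False
    then obtain l h where l: "l \<in> {1..n}" and r: "raise l g h" by (auto simp: highest_def)
    have h: "h \<in> patterns" using raise_patterns less.prems l r by auto
    obtain p where hp: "h = g(l := (g l)(p := g l p + 1))" using r by (auto simp: raise_def)
    have p: "p < n"
    proof (rule ccontr)
      assume "\<not> p < n"
      then have "h l p = 0" "g l p = 0" using l h less.prems pattern_zero by auto
      then show False by (simp add: hp)
    qed
    let ?S = "\<lambda>g. \<Sum>l\<in>{1..n}. \<Sum>r<n. g (Suc n) r - g l r :: int"
    have ht: "h (Suc n) = g (Suc n)" using l by (auto simp: hp)
    have ge: "g m r \<le> h m r" for m r by (simp add: hp)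
    have S: "?S h < ?S g" unfolding ht
    proof (rule sum_strict_mono_ex1)
      have "(\<Sum>r<n. g (Suc n) r - h l r) < (\<Sum>r<n. g (Suc n) r - g l r)"
        by (rule sum_strict_mono_ex1) (use ge p in \<open>auto simp: hp\<close>)
      then show "\<exists>l\<in>{1..n}. (\<Sum>r<n. g (Suc n) r - h l r) < (\<Sum>r<n. g (Suc n) r - g l r)"
        using l by blast
    qed (auto intro!: sum_mono ge)
    have "0 \<le> ?S h"
      using pattern_mono[OF h] by (intro sum_nonneg) auto
    then obtain w g' where "set w \<subseteq> {1..n}" "raises w h g'" "g' \<in> patterns" "highest n g'"
      using less.hyps[OF _ h] S by (auto simp: zless_nat_conj)
    then show ?thesis using l r
      by (intro exI[of _ "l # w"] exI[of _ g']) (auto intro: raises.Cons)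
  qed
qed

section \<open>The commutation relation on patterns\<close>

lemma toggle_q_conj_commute:
  assumes g: "g \<in> patterns" and i: "1 \<le> i" "i < s"
  shows "toggle i (unpromote n s (toggle_q n (promote n s g))) =
    unpromote n s (toggle_q n (promote n s (toggle i g)))"
proof -
  let ?P = "promote n s" and ?U = "unpromote n s" and ?q = "toggle_q n"
  note pat = promote_patterns unpromote_patterns toggle_q_patterns toggle_patterns[OF _ i(1)]
  define X where "X = ?P g"
  define X' where "X' = ?q X"
  have X: "X \<in> patterns" "X' \<in> patterns" unfolding X_def X'_def by (intro pat g)+
  obtain w H where w: "set w \<subseteq> {1..n}" "raises w X H" "H \<in> patterns" "highest n H"
    using raises_highest[OF X(1)] by blast
  obtain w' H' where w': "set w' \<subseteq> {1..n}" "raises w' X' H'" "H' \<in> patterns" "highest n H'"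
    using raises_highest[OF X(2)] by blast
  \<comment> \<open>Neither \<open>toggle_q n\<close> nor the raisings change levels above
    \<open>n\<close>, so the two highest weight patterns share level \<open>Suc n\<close>, which
    determines the levels below it.\<close>
  have above: "H m = H' m" if "n < m" for m
  proof -
    have "m \<notin> set w" "m \<notin> set w'" using w(1) w'(1) that by auto
    then have "H m = X m" "H' m = X' m" using raises_other w(2) w'(2) by blast+
    then show ?thesis using toggle_q_above[OF that] by (simp add: X'_def)
  qed
  have "H m = H' m" for m
    using highest_unique_top[OF w(3,4) w'(3,4) above[OF lessI], of m] above[of m] by (cases "n < m") auto
  then have HH: "H' = H" by (simp add: fun_eq_iff)
  define \<theta> where "\<theta> = (\<lambda>f. ?P (toggle i (?U f)))"
  have tp: "\<theta> f \<in> patterns" if "f \<in> patterns" for f unfolding \<theta>_def by (intro pat that)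
  have lift: "raise l (\<theta> f) (\<theta> f') \<longleftrightarrow> raise l f f'" if "f \<in> patterns" "l \<in> {1..n}" for f f' l
  proof -
    have "raise l (\<theta> f) (\<theta> f') \<longleftrightarrow> raise (l + s) (toggle i (?U f)) (toggle i (?U f'))"
      unfolding \<theta>_def by (rule raise_promote_iff) (use that pat in auto)
    also have "\<dots> \<longleftrightarrow> raise (l + s) (?U f) (?U f')"
      by (rule raise_toggle_iff) (use i that in auto)
    also have "\<dots> \<longleftrightarrow> raise l (?P (?U f)) (?P (?U f'))"
      by (rule raise_promote_iff[symmetric]) (use that pat in auto)
    finally show ?thesis by (simp add: promote_unpromote)
  qed
  have lifts: "raises v (\<theta> f) (\<theta> f')" if "raises v f f'" "f \<in> patterns" "set v \<subseteq> {1..n}" for v f f'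
    using raises_map[OF that(1,2), where \<phi> = "\<lambda>l. l" and f = \<theta>] lift that(3) by force
  have Y: "raises w (\<theta> X) (\<theta> H)" "raises w' (\<theta> X') (\<theta> H)"
    using lifts w w' X HH by auto
  \<comment> \<open>The map \<theta> is an involution, so a raising of \<open>\<theta> H\<close>
    would pull back to one of \<open>H\<close>.\<close>
  have hi: "highest n (\<theta> H)"
  proof -
    have "raise l H (\<theta> f)" if "raise l (\<theta> H) f" "l \<in> {1..n}" for l f
    proof -
      have "\<theta> (\<theta> f) = f"
        by (simp add: \<theta>_def unpromote_promote toggle_toggle[OF i(1)] promote_unpromote)
      then show ?thesis using lift[OF w(3) that(2), of "\<theta> f"] that(1) by simp
    qed
    then show ?thesis using w(4) unfolding highest_def by blast
  qed
  have size: "level_size m (\<theta> H) = level_size m H" if "m \<le> Suc n" for m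
  proof -
    have "level_size m (\<theta> H) = level_size (m + s) (?U H) - level_size s (?U H)"
      unfolding \<theta>_def using that i pat w(3) by (simp add: level_size_promote level_size_toggle_other)
    also have "\<dots> = level_size m (?P (?U H))"
      using that pat w(3) by (simp add: level_size_promote)
    finally show ?thesis by (simp add: promote_unpromote)
  qed
  have HT: "\<theta> H m = H m" if "m \<le> Suc n" for m
    by (rule highest_unique_size[OF tp[OF w(3)] hi w(3,4) size that])
  have XT: "\<theta> X m = X m" if "m \<le> Suc n" for m
    by (rule raises_agree_below[OF Y(1) w(2,1) HT that])
  have XT': "\<theta> X' m = X' m" if "m \<le> Suc n" for m
    by (rule raises_agree_below[OF Y(2) w'(2)[unfolded HH] w'(1) HT that])
  \<comment> \<open>Up to level \<open>Suc n\<close>, \<theta> fixes both \<open>X\<close> and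
    \<open>X'\<close> and \<open>?q\<close> reads nothing higher; above, \<open>?q\<close> does
    nothing and both sides agree with \<open>\<theta> H\<close>.\<close>
  have "?q (\<theta> X) m = \<theta> X' m" for m
  proof (cases "m \<le> Suc n")
    case True
    then show ?thesis using toggle_q_cong[OF XT True] XT'[OF True] by (simp add: X'_def)
  next
    case False
    then have "m \<notin> set w" "m \<notin> set w'" using w(1) w'(1) by auto
    then have "\<theta> H m = \<theta> X m" "\<theta> H m = \<theta> X' m"
      using raises_other Y by blast+
    then show ?thesis using False by (simp add: toggle_q_above)
  qed
  then have "?q (\<theta> X) = \<theta> X'" by (rule ext)
  then have "?U (?q (?P (toggle i (?U X)))) = toggle i (?U X')"
    by (simp only: \<theta>_def unpromote_promote)
  then show ?thesis by (simp only: X'_def X_def unpromote_promote)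
qed

section \<open>Tableaux as patterns\<close>

text \<open>The Gelfand-Tsetlin pattern: level \<open>m\<close> is the shape of the boxes with
  entries up to \<open>m\<close>. Positivity excludes positions outside the diagram.\<close>

definition pattern_of :: "tableau \<Rightarrow> pattern" where
  "pattern_of T m r = int (card {c. 0 < T r c \<and> T r c \<le> m})"

lemma ssyt_of_shape_pos_iff:
  assumes "T \<in> ssyt_of_shape p"
  shows "0 < T r c \<longleftrightarrow> (r, c) \<in> diagram p"
proof (cases "(r, c) \<in> diagram p")
  case True
  then have "0 < T r c" using assms unfolding ssyt_of_shape_def by blast
  then show ?thesis using True by simp
next
  case False
  then have "T r c = 0" using assms unfolding ssyt_of_shape_def by blast
  then show ?thesis using False by simp
qed

lemma SSYT_row:
  assumes "T \<in> SSYT" "0 < T r c'" "c \<le> c'"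
  shows "0 < T r c \<and> T r c \<le> T r c'"
proof -
  obtain p where p: "T \<in> ssyt_of_shape p" using assms(1) by (auto simp: SSYT_def)
  note pos = ssyt_of_shape_pos_iff[OF p]
  have "c < c' \<longrightarrow> T r c \<le> T r c'"
    using p assms(2) unfolding pos ssyt_of_shape_def by blast
  then show ?thesis using diagram_left[of r c' p c] assms(2,3) pos by (cases "c = c'") auto
qed

lemma SSYT_col:
  assumes "T \<in> SSYT" "0 < T r' c" "r < r'"
  shows "0 < T r c \<and> T r c < T r' c"
proof -
  obtain p where p: "is_partition p" "T \<in> ssyt_of_shape p" using assms(1) by (auto simp: SSYT_def)
  note pos = ssyt_of_shape_pos_iff[OF p(2)]
  have "T r c < T r' c"
    using p(2) assms(2,3) unfolding pos ssyt_of_shape_def by blast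
  then show ?thesis using diagram_up[OF p(1), of r' c r] assms(2,3) pos by simp
qed

lemma finite_SSYT_row: "T \<in> SSYT \<Longrightarrow> finite {c. 0 < T r c}"
  by (auto simp: SSYT_def ssyt_of_shape_pos_iff finite_diagram_row)

lemma initial_segment:
  fixes S :: "nat set"
  assumes "finite S" "\<And>x y. y \<in> S \<Longrightarrow> x \<le> y \<Longrightarrow> x \<in> S"
  shows "S = {..<card S}"
proof (cases "S = {}")
  case False
  have "S = {..Max S}" using assms Max_in[OF assms(1) False] Max_ge[OF assms(1)] by blast
  then show ?thesis by (metis card_atMost lessThan_Suc_atMost)
qed simp

text \<open>The boxes counted form an initial segment of the row, so the count is a threshold for
  the columns.\<close>

lemma pattern_of_iff:
  assumes T: "T \<in> SSYT"
  shows "int c < pattern_of T m r \<longleftrightarrow> 0 < T r c \<and> T r c \<le> m"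
proof -
  let ?S = "{c. 0 < T r c \<and> T r c \<le> m}"
  have "finite ?S" using finite_SSYT_row[OF T, of r] by (rule finite_subset[rotated]) auto
  then have "?S = {..<card ?S}"
    by (rule initial_segment) (use SSYT_row[OF T] in \<open>auto intro: order_trans\<close>)
  then have "c \<in> ?S \<longleftrightarrow> c \<in> {..<card ?S}" by (rule arg_cong)
  then show ?thesis by (simp add: pattern_of_def)
qed

lemma pattern_of_nonneg: "0 \<le> pattern_of T m r"
  by (simp add: pattern_of_def)

lemma pattern_of_leI:
  assumes "T \<in> SSYT" "T' \<in> SSYT"
    and "\<And>c. 0 < T r c \<Longrightarrow> T r c \<le> m \<Longrightarrow> 0 < T' r' c \<and> T' r' c \<le> m'"
  shows "pattern_of T m r \<le> pattern_of T' m' r'"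
proof (rule ccontr)
  obtain c where c: "pattern_of T' m' r' = int c" by (simp add: pattern_of_def)
  assume "\<not> ?thesis"
  then have "int c < pattern_of T m r" using c by simp
  then have "int c < pattern_of T' m' r'"
    unfolding pattern_of_iff[OF assms(1)] pattern_of_iff[OF assms(2)] using assms(3) by blast
  then show False using c by simp
qed

lemma pattern_of_patterns:
  assumes T: "T \<in> SSYT"
  shows "pattern_of T \<in> patterns"
proof -
  have "pattern_of T (Suc m) (Suc r) \<le> pattern_of T m r" for m r
  proof (rule pattern_of_leI[OF T T])
    fix c assume "0 < T (Suc r) c" "T (Suc r) c \<le> Suc m"
    then show "0 < T r c \<and> T r c \<le> m" using SSYT_col[OF T, of "Suc r" c r] by simp
  qed
  moreover have "pattern_of T m r \<le> pattern_of T (Suc m) r" for m r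
    by (rule pattern_of_leI[OF T T]) auto
  moreover have "pattern_of T 0 r = 0" for r
  proof -
    have e: "{c. 0 < T r c \<and> T r c \<le> 0} = {}" by auto
    show ?thesis unfolding pattern_of_def e by simp
  qed
  ultimately show ?thesis by (simp add: patterns_def)
qed

lemma pattern_of_inj:
  assumes "T \<in> SSYT" "T' \<in> SSYT" "pattern_of T = pattern_of T'"
  shows "T = T'"
proof (intro ext)
  fix r c
  have "0 < T r c \<and> T r c \<le> m \<longleftrightarrow> 0 < T' r c \<and> T' r c \<le> m" for m
    using pattern_of_iff assms by metis
  from this[of "T r c"] this[of "T' r c"] show "T r c = T' r c" by auto
qed

lemma card_int_interval: "card {c. x \<le> int c \<and> int c < y} = nat (y - max 0 x)"
proof -
  have "{c. x \<le> int c \<and> int c < y} = {nat x..<nat y}"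
    by (auto simp: nat_le_iff zless_nat_eq_int_zless)
  then show ?thesis by (simp add: nat_diff_distrib')
qed

text \<open>After the move, the entries up to \<open>i\<close> in row \<open>r\<close> are those
  below \<open>i\<close>, the non-free \<open>i\<close>, and as many free boxes as there were free
  \<open>i + 1\<close>. The last two numbers give the maximum and the minimum in
  \<open>flip\<close>.\<close>

lemma pattern_of_bender_knuth:
  assumes T: "T \<in> SSYT" and i: "1 \<le> i"
  shows "pattern_of (bender_knuth i T) = toggle i (pattern_of T)"
proof (intro ext)
  fix m r
  let ?L = "pattern_of T" and ?B = "bender_knuth i T"
  note L = pattern_of_iff[OF T] and P = patternsD[OF pattern_of_patterns[OF T]]
  show "pattern_of ?B m r = toggle i ?L m r"
  proof (cases "m = i")
    case False
    have "0 < ?B r c \<and> ?B r c \<le> m \<longleftrightarrow> 0 < T r c \<and> T r c \<le> m" for c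
    proof (cases "T r c \<in> {i, Suc i}")
      case True
      then have "?B r c \<in> {i, Suc i}" by (simp only: bender_knuth_mem_iff)
      then show ?thesis using True False i by auto
    qed (simp add: bender_knuth_other)
    then show ?thesis using False by (simp add: pattern_of_def toggle_def)
  next
    case True
    let ?F = "free_cols i T r"
    define k where "k = card {c \<in> ?F. T r c = Suc i}"
    obtain p where Tp: "T \<in> ssyt_of_shape p" using T by (auto simp: SSYT_def)
    have fin: "finite ?F" by (rule finite_free_cols[OF Tp i])
    obtain i' where i': "i = Suc i'" using i by (cases i) auto
    have Tle: "T s c \<le> i \<longleftrightarrow> T s c \<le> i' \<or> T s c = i" for s c using i' by auto
    \<comment> \<open>An \<open>i\<close> is non-free exactly when \<open>i + 1\<close> stands
      directly below it, by strictness of columns.\<close>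
    have blocked: "T r c = i \<and> c \<notin> ?F \<longleftrightarrow> ?L i' r \<le> int c \<and> int c < ?L (Suc i) (Suc r)" for c
    proof
      assume a: "T r c = i \<and> c \<notin> ?F"
      then obtain s where s: "T s c \<in> {i, Suc i}" "s \<noteq> r" unfolding free_cols_def by blast
      have "\<not> s < r" using SSYT_col[OF T, of r c s] a s i by force
      then have rs: "Suc r \<le> s" using s by simp
      have "0 < T (Suc r) c \<and> T (Suc r) c \<le> T s c"
        using SSYT_col[OF T, of s c "Suc r"] rs s i by (cases "s = Suc r") auto
      then have "0 < T (Suc r) c \<and> T (Suc r) c \<le> Suc i" using s by auto
      then have "int c < ?L (Suc i) (Suc r)" by (simp add: L)
      moreover have "\<not> int c < ?L i' r" unfolding L using a i' by simp
      ultimately show "?L i' r \<le> int c \<and> int c < ?L (Suc i) (Suc r)" by simp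
    next
      assume a: "?L i' r \<le> int c \<and> int c < ?L (Suc i) (Suc r)"
      then have "0 < T (Suc r) c \<and> T (Suc r) c \<le> Suc i" and b': "\<not> (0 < T r c \<and> T r c \<le> i')"
        unfolding L[symmetric] by simp_all
      then have b: "0 < T (Suc r) c" "T (Suc r) c \<le> Suc i" by auto
      then have e: "T r c = i" "T (Suc r) c = Suc i"
        using SSYT_col[OF T b(1), of r] b b' i' by auto
      then have "c \<notin> ?F" using free_cols_unique[of c i T r "Suc r"] by auto
      then show "T r c = i \<and> c \<notin> ?F" using e by simp
    qed
    let ?ub = "if r = 0 then ?L (Suc i) 0 else min (?L i' (r - 1)) (?L (Suc i) r)"
    \<comment> \<open>An \<open>i + 1\<close> is free exactly when it is in row 0 or the entry above
      it is less than \<open>i\<close>.\<close>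
    have free: "c \<in> ?F \<and> T r c = Suc i \<longleftrightarrow> ?L i r \<le> int c \<and> int c < ?ub" for c
    proof -
      have val: "T r c = Suc i \<longleftrightarrow> ?L i r \<le> int c \<and> int c < ?L (Suc i) r"
        unfolding not_less[symmetric] L by auto
      have "c \<in> ?F \<longleftrightarrow> r = 0 \<or> int c < ?L i' (r - 1)" if e: "T r c = Suc i"
      proof
        assume f: "c \<in> ?F"
        show "r = 0 \<or> int c < ?L i' (r - 1)"
        proof (cases r)
          case (Suc s)
          have "0 < T s c \<and> T s c < T r c" using SSYT_col[OF T, of r c s] e Suc by simp
          moreover have "T s c \<noteq> i" using free_cols_unique[OF f, of s] Suc by auto
          ultimately show ?thesis using Suc e i' by (simp add: L)
        qed simp
      next
        assume f: "r = 0 \<or> int c < ?L i' (r - 1)"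
        have "s = r" if s: "T s c \<in> {i, Suc i}" for s
        proof (rule ccontr)
          assume "s \<noteq> r"
          moreover have "\<not> r < s" using SSYT_col[OF T, of s c r] s e i by auto
          ultimately have "s \<le> r - 1" "0 < r" by auto
          then have "T s c \<le> T (r - 1) c" "T (r - 1) c \<le> i'"
            using f SSYT_col[OF T, of "r - 1" c s] by (auto simp: L) (cases "s = r - 1"; simp)+
          then show False using s i' by auto
        qed
        then show "c \<in> ?F" using e unfolding free_cols_def by blast
      qed
      then show ?thesis using val by (cases "r = 0") auto
    qed
    have k: "int k = ?ub - ?L i r"
    proof -
      have "?L i r \<le> ?ub" using P(2)[of i r] P(3)[of i' "r - 1"] i' by auto
      then show ?thesis unfolding k_def free card_int_interval
        using pattern_of_nonneg[of T i r] by simp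
    qed
    have "{c. 0 < ?B r c \<and> ?B r c \<le> i} =
      {c. 0 < T r c \<and> T r c \<le> i'} \<union> {c. T r c = i \<and> c \<notin> ?F} \<union> {c \<in> ?F. card {c' \<in> ?F. c' < c} < k}"
      (is "_ = ?X \<union> ?Y \<union> ?Z")
    proof (rule Set.set_eqI)
      fix c
      show "c \<in> {c. 0 < ?B r c \<and> ?B r c \<le> i} \<longleftrightarrow> c \<in> ?X \<union> ?Y \<union> ?Z"
        using free_cols_entry[of c i T r] i'
        by (cases "c \<in> ?F") (auto simp: bender_knuth_def Let_def k_def)
    qed
    moreover have "finite ?X" "finite ?Y" using finite_SSYT_row[OF T, of r] i
      by (auto elim!: finite_subset[rotated])
    moreover have "?X \<inter> ?Y = {}" "(?X \<union> ?Y) \<inter> ?Z = {}"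
      using free_cols_entry i' by fastforce+
    ultimately have "card {c. 0 < ?B r c \<and> ?B r c \<le> i} = card ?X + card ?Y + card ?Z"
      using fin by (simp add: card_Un_disjoint)
    moreover have "card ?Z = k"
      using card_rank_less[OF fin] card_mono[OF fin, of "{c \<in> ?F. T r c = Suc i}"] by (simp add: k_def)
    moreover have "int (card ?Y) = max (?L i' r) (?L (Suc i) (Suc r)) - ?L i' r"
      unfolding blocked card_int_interval using pattern_of_nonneg[of T i' r] by simp
    ultimately have "pattern_of ?B i r = max (?L i' r) (?L (Suc i) (Suc r)) + (?ub - ?L i r)"
      using k by (simp add: pattern_of_def)
    then show ?thesis using True by (simp add: toggle_def flip_def i')
  qed
qed

section \<open>Transfer to the Berenstein-Kirillov group\<close>

text \<open>Membership in the carrier is included because the group product is composition only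
  there.\<close>

definition acts_as :: "(tableau \<Rightarrow> tableau) \<Rightarrow> (pattern \<Rightarrow> pattern) \<Rightarrow> bool" where
  "acts_as a f \<longleftrightarrow> a \<in> carrier BK \<and> (\<forall>T\<in>SSYT. a T \<in> SSYT \<and> pattern_of (a T) = f (pattern_of T))"

lemma carrier_BK_Bij: "carrier BK \<subseteq> Bij SSYT"
proof -
  have "carrier BK \<subseteq> carrier (BijGroup SSYT)"
    unfolding BK_def by (rule group.carrier_subgroup_generated_subset[OF group_BijGroup])
  then show ?thesis by (simp add: BijGroup_def)
qed

lemma one_BK: "\<one>\<^bsub>BK\<^esub> = (\<lambda>T\<in>SSYT. T)"
  by (simp add: BK_def BijGroup_def)

lemma mult_BK:
  "a \<in> carrier BK \<Longrightarrow> b \<in> carrier BK \<Longrightarrow> T \<in> SSYT \<Longrightarrow> (a \<otimes>\<^bsub>BK\<^esub> b) T = a (b T)"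
  using carrier_BK_Bij by (auto simp: BK_def BijGroup_def compose_def)

lemma acts_as_one: "acts_as \<one>\<^bsub>BK\<^esub> id"
  using monoid.one_closed[OF group.is_monoid[OF group_BK]] by (simp add: acts_as_def) (simp add: one_BK)

lemma acts_as_mult: "acts_as a f \<Longrightarrow> acts_as b g \<Longrightarrow> acts_as (a \<otimes>\<^bsub>BK\<^esub> b) (f \<circ> g)"
  using group.is_monoid[OF group_BK] by (simp add: acts_as_def mult_BK monoid.m_closed)

lemma acts_as_move: "1 \<le> i \<Longrightarrow> acts_as (bk_move i) (toggle i)"
  using bk_move_in_BK bender_knuth_SSYT pattern_of_bender_knuth
  by (simp add: acts_as_def bk_move_def)

lemma acts_as_desc: "acts_as (bk_desc m) (toggle_desc m)"
proof (induction m)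
  case (Suc m)
  show ?case unfolding bk_desc.simps toggle_desc.simps
    by (rule acts_as_mult[OF acts_as_move Suc]) simp
qed (simp only: bk_desc.simps toggle_desc.simps acts_as_one)

lemma acts_as_q: "acts_as (bk_q m) (toggle_q m)"
proof (induction m)
  case (Suc m)
  show ?case unfolding bk_q.simps toggle_q.simps
    by (rule acts_as_mult[OF Suc acts_as_desc])
qed (simp only: bk_q.simps toggle_q.simps acts_as_one)

text \<open>Tableaux are determined by their patterns, and group elements, being extensional, by
  their values on tableaux.\<close>

lemma acts_as_eq_one:
  assumes "acts_as a f" and "\<And>g. g \<in> patterns \<Longrightarrow> f g = g"
  shows "a = \<one>\<^bsub>BK\<^esub>"
proof -
  have "a T = T" if "T \<in> SSYT" for T
    using assms that pattern_of_patterns by (intro pattern_of_inj) (simp_all add: acts_as_def)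
  moreover have "a \<in> extensional SSYT"
    using assms(1) carrier_BK_Bij by (auto simp: acts_as_def Bij_def)
  ultimately show ?thesis unfolding one_BK by (intro extensionalityI[of a SSYT]) auto
qed

theorem theorem1p6:
  fixes i j k :: nat
  assumes "1 \<le> i" and "i + 1 < j" and "j < k"
  shows "(bk_move i \<otimes>\<^bsub>BK\<^esub> bk_q_interval j k) [^]\<^bsub>BK\<^esub> (2::nat) = \<one>\<^bsub>BK\<^esub>"
proof -
  \<comment> \<open>Chosen so that \<open>k - 1 = n + s\<close>; the hypothesis
    \<open>i + 1 < j\<close> becomes \<open>i < s\<close>.\<close>
  define n s where "n = k - j" and "s = j - 1"
  have k: "k - 1 = n + s" and i: "1 \<le> i" "i < s" using assms by (auto simp: n_def s_def)
  define Q where "Q = toggle_q (n + s) \<circ> toggle_q n \<circ> toggle_q (n + s)"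
  have conj: "Q g = unpromote n s (toggle_q n (promote n s g))" for g
    by (simp add: Q_def toggle_q_conj)
  have comm: "toggle i (Q g) = Q (toggle i g)" if "g \<in> patterns" for g
    using toggle_q_conj_commute[OF that i] by (simp add: conj)
  have QQ: "Q (Q g) = g" for g by (simp add: Q_def toggle_q_toggle_q)
  have Q: "acts_as (bk_q_interval j k) Q"
    unfolding bk_q_interval_def k n_def[symmetric] Q_def by (intro acts_as_mult acts_as_q)
  have x: "acts_as (bk_move i \<otimes>\<^bsub>BK\<^esub> bk_q_interval j k) (toggle i \<circ> Q)" (is "acts_as ?x _")
    by (intro acts_as_mult acts_as_move Q i)
  \<comment> \<open>The two involutions \<open>toggle i\<close> and \<open>Q\<close> commute on
    patterns, so their product squares to the identity.\<close>
  have "?x \<otimes>\<^bsub>BK\<^esub> ?x = \<one>\<^bsub>BK\<^esub>"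
    by (rule acts_as_eq_one[OF acts_as_mult[OF x x]])
      (simp add: comm toggle_patterns[OF _ i(1)] QQ toggle_toggle[OF i(1)])
  moreover have "?x \<in> carrier BK" using x by (simp add: acts_as_def)
  ultimately show ?thesis
    using group.is_monoid[OF group_BK]
    by (simp add: numeral_2_eq_2 monoid.nat_pow_Suc monoid.nat_pow_0 monoid.l_one)
qed

end
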